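(* Let $\alpha\in\mathbb{C}$ with $|\mathrm{Re}\sqrt\alpha|<1$. Then the operator $Q_\alpha$ is bounded on $L^2(\mathbb{R}_+)$, and $$\|Q_\alpha\|=\frac{1}{\mathrm{dist}\big(\alpha,(1+\mathrm{i}\mathbb{R})^2\big)}.$$
   Context: $\mathbb{R}_+=]0,\infty[$. $\theta$ is the Heaviside function. $Q_\alpha$ is the integral operator $(Q_\alpha g)(x)=\int_0^\infty Q_\alpha(x,y)g(y)\,dy$ with kernel $$Q_\alpha(x,y)=\frac{1}{2m}\big(x^{-\frac32+m}y^{\frac12-m}-x^{-\frac32-m}y^{\frac12+m}\big)\theta(x-y)\quad(\alpha=m^2\neq0),$$ $$Q_0(x,y)=x^{-\frac32}y^{\frac12}\log\Big(\frac xy\Big)\theta(x-y)\quad(\alpha=0).$$ Here $m$ is a square root of $\alpha$ (the kernel does not depend on which one), and $|\mathrm{Re}\sqrt\alpha|$ does not depend on the choice of the root. $(1+\mathrm{i}\mathbb{R})^2=\{(1+\mathrm{i}\omega)^2 : \omega\in\mathbb{R}\}$ is a parabola in $\mathbb{C}$ and $\mathrm{dist}$ is the Euclidean distance in $\mathbb{C}$. *)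

theory Defs
  imports "HOL-Analysis.Analysis"
begin

abbreviation pos_lebesgue :: "real measure" where
  "pos_lebesgue \<equiv> lebesgue_on {0<..}"

text \<open>Elements of \<open>L\<^sup>2(]0,\<infinity>[)\<close> are represented by functions instead of classes modulo null
  sets; accordingly, linearity of operators is required only almost everywhere.\<close>

definition L2_pos :: "(real \<Rightarrow> complex) set" where
  "L2_pos = {g \<in> borel_measurable pos_lebesgue. integrable pos_lebesgue (\<lambda>x. (cmod (g x))\<^sup>2)}"

definition L2_norm :: "(real \<Rightarrow> complex) \<Rightarrow> real" where
  "L2_norm g = sqrt (\<integral>x. (cmod (g x))\<^sup>2 \<partial>pos_lebesgue)"

text \<open>Together with the norm bound, a.e. linearity implies that the operator respects equality
  almost everywhere, so that it descends to a bounded operator on the quotient space.\<close>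

definition L2_bounded_operator :: "((real \<Rightarrow> complex) \<Rightarrow> real \<Rightarrow> complex) \<Rightarrow> bool" where
  "L2_bounded_operator T \<longleftrightarrow>
     (\<forall>g\<in>L2_pos. T g \<in> L2_pos) \<and>
     (\<forall>g\<in>L2_pos. \<forall>h\<in>L2_pos. AE x in pos_lebesgue. T (\<lambda>y. g y + h y) x = T g x + T h x) \<and>
     (\<forall>c. \<forall>g\<in>L2_pos. AE x in pos_lebesgue. T (\<lambda>y. c * g y) x = c * T g x) \<and>
     (\<exists>C. \<forall>g\<in>L2_pos. L2_norm (T g) \<le> C * L2_norm g)"

text \<open>The analogue of \<^const>\<open>onorm\<close>; functions of norm 0 contribute the value 0 because division
  by 0 yields 0. The supremum is meaningful only for bounded operators.\<close>

definition L2_onorm :: "((real \<Rightarrow> complex) \<Rightarrow> real \<Rightarrow> complex) \<Rightarrow> real" where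
  "L2_onorm T = (SUP g\<in>L2_pos. L2_norm (T g) / L2_norm g)"

definition heaviside :: "real \<Rightarrow> real" where
  "heaviside t = (if t \<ge> 0 then 1 else 0)"

text \<open>The kernel is meant for \<open>x, y > 0\<close> only, where the complex powers are
  \<open>x powr z = exp (z * ln x)\<close> with the real logarithm. The principal root is used here; the
  lemmas below show that the choice is immaterial.\<close>

definition Q_kernel :: "complex \<Rightarrow> real \<Rightarrow> real \<Rightarrow> complex" where
  "Q_kernel \<alpha> x y =
     (if \<alpha> = 0
      then of_real x powr (- 3/2) * of_real y powr (1/2) * of_real (ln (x / y)) * of_real (heaviside (x - y))
      else let m = csqrt \<alpha> in
        1 / (2 * m) *
          (of_real x powr (- 3/2 + m) * of_real y powr (1/2 - m)
           - of_real x powr (- 3/2 - m) * of_real y powr (1/2 + m)) * of_real (heaviside (x - y)))"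

lemma square_root_cases:
  fixes m \<alpha> :: complex
  assumes "m\<^sup>2 = \<alpha>"
  shows "csqrt \<alpha> = m \<or> csqrt \<alpha> = - m"
  using assms power2_csqrt[of \<alpha>] by (metis power2_eq_iff)

lemma Q_kernel_square_root:
  assumes "m\<^sup>2 = \<alpha>" and "\<alpha> \<noteq> 0"
  shows "Q_kernel \<alpha> x y =
    1 / (2 * m) *
      (of_real x powr (- 3/2 + m) * of_real y powr (1/2 - m)
       - of_real x powr (- 3/2 - m) * of_real y powr (1/2 + m)) * of_real (heaviside (x - y))"
  using square_root_cases[OF assms(1)]
proof
  assume "csqrt \<alpha> = m"
  then show ?thesis using assms(2) by (simp add: Q_kernel_def Let_def)
next
  assume "csqrt \<alpha> = - m"
  have swap: "1 / (2 * - m) * (a - b) * c = 1 / (2 * m) * (b - a) * c" for a b c :: complex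
  proof -
    have "b - a = - (a - b)" by simp
    then show ?thesis by (simp only: mult_minus_right mult_minus_left divide_minus_right)
  qed
  show ?thesis
    using assms(2) \<open>csqrt \<alpha> = - m\<close> swap
    unfolding Q_kernel_def Let_def
    by (simp only: if_False diff_minus_eq_add add_uminus_conv_diff)
qed

lemma abs_Re_square_root:
  assumes "m\<^sup>2 = \<alpha>"
  shows "\<bar>Re (csqrt \<alpha>)\<bar> = \<bar>Re m\<bar>"
  using square_root_cases[OF assms] by (metis abs_minus_cancel uminus_complex.simps(1))

definition Q_op :: "complex \<Rightarrow> (real \<Rightarrow> complex) \<Rightarrow> real \<Rightarrow> complex" where
  "Q_op \<alpha> g x = (\<integral>y. Q_kernel \<alpha> x y * g y \<partial>pos_lebesgue)"

text \<open>The library integral is 0 for non-integrable functions; this predicate states that the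
  integral defining \<open>Q_op \<alpha> g\<close> really exists almost everywhere for each square-integrable \<open>g\<close>.\<close>

definition Q_op_well_defined :: "complex \<Rightarrow> bool" where
  "Q_op_well_defined \<alpha> \<longleftrightarrow>
     (\<forall>g\<in>L2_pos. AE x in pos_lebesgue. integrable pos_lebesgue (\<lambda>y. Q_kernel \<alpha> x y * g y))"

end

theory Submission
  imports Defs
begin

text \<open>
  In the coordinates \<open>w(s) = e\<^sup>s\<^sup>/\<^sup>2 h(e\<^sup>s)\<close> the operator is a convolution and \<open>h = Q_op \<alpha> g\<close> becomes the
  equation \<open>w'' + 2 w' + (1 - \<alpha>) w = e\<^sup>s\<^sup>/\<^sup>2 g(e\<^sup>s)\<close>, whose symbol is \<open>p(\<omega>) = (1 + \<i>\<omega>)\<^sup>2 - \<alpha>\<close>. The norm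
  is thus \<open>1 / d\<close>, where \<open>d\<close> is the minimum of \<open>\<bar>p\<bar>\<close> on the real line. Plancherel's theorem is avoided.

  Upper bound: \<open>\<bar>p\<bar>\<^sup>2 - d\<^sup>2\<close> is a nonnegative quartic with a double zero at a minimum point \<open>\<omega>\<close>, hence equal to
  \<open>\<bar>q\<bar>\<^sup>2\<close> for a quadratic polynomial \<open>q\<close>. Consequently \<open>\<bar>p(\<partial>) w\<bar>\<^sup>2 - d\<^sup>2 \<bar>w\<bar>\<^sup>2 - \<bar>q(\<partial>) w\<bar>\<^sup>2\<close> is the derivative of
  a quadratic form in \<open>w\<close> and \<open>w'\<close>, which vanishes at both ends when \<open>g\<close> is continuous with compact support.
  General \<open>g\<close> follow by density and Fatou's lemma, since \<open>Q_kernel \<alpha> x\<close> is square integrable for each \<open>x\<close>.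

  Lower bound: \<open>w(s) = exp (\<i>\<omega>s) / cosh (\<epsilon>s)\<close> is an approximate eigenfunction in the pointwise sense
  \<open>\<bar>p(\<partial>) w\<bar> \<le> (d + O(\<epsilon>)) \<bar>w\<bar>\<close>.
\<close>

section \<open>The kernel in logarithmic coordinates\<close>

text \<open>The solution of \<open>f'' = m\<^sup>2 f\<close> with \<open>f 0 = 0\<close> and
  \<open>f' 0 = 1\<close>, whose derivative is \<open>cosh_mult m\<close>. Filling in the value at
  \<open>m = 0\<close> lets one formula cover both the power kernel and the logarithmic
  kernel.\<close>

definition sinh_div :: "complex \<Rightarrow> real \<Rightarrow> complex" where
  "sinh_div m u = (if m = 0 then of_real u else sinh (m * of_real u) / m)"

definition cosh_mult :: "complex \<Rightarrow> real \<Rightarrow> complex" where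
  "cosh_mult m u = cosh (m * of_real u)"

lemma sinh_div_0 [simp]: "sinh_div m 0 = 0"
  by (simp add: sinh_div_def)

lemma cosh_mult_0 [simp]: "cosh_mult m 0 = 1"
  by (simp add: cosh_mult_def)

lemma sinh_div_has_vector_derivative:
  "(sinh_div m has_vector_derivative cosh_mult m u) (at u within A)"
proof (cases "m = 0")
  case True
  then show ?thesis
    unfolding sinh_div_def cosh_mult_def
    by (auto intro!: derivative_eq_intros simp: has_vector_derivative_of_real has_real_derivative_iff_has_vector_derivative[symmetric])
next
  case False
  have "((\<lambda>z. sinh (m * z) / m) has_field_derivative cosh (m * of_real u)) (at (of_real u))"
    using False by (auto intro!: derivative_eq_intros)
  from has_vector_derivative_real_field[OF this] show ?thesis
    using False by (simp add: sinh_div_def[abs_def] cosh_mult_def)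
qed

lemma cosh_mult_has_vector_derivative:
  "(cosh_mult m has_vector_derivative m\<^sup>2 * sinh_div m u) (at u within A)"
proof -
  have "((\<lambda>z. cosh (m * z)) has_field_derivative m * sinh (m * of_real u)) (at (of_real u))"
    by (auto intro!: derivative_eq_intros)
  from has_vector_derivative_real_field[OF this] show ?thesis
    by (cases "m = 0") (simp_all add: sinh_div_def cosh_mult_def[abs_def] power2_eq_square)
qed

lemma continuous_on_sinh_div [continuous_intros]:
  "continuous_on A f \<Longrightarrow> continuous_on A (\<lambda>x. sinh_div m (f x))"
  by (rule continuous_on_compose2[of UNIV "sinh_div m" A f])
    (auto intro!: continuous_on_vector_derivative sinh_div_has_vector_derivative)

lemma continuous_on_cosh_mult [continuous_intros]:
  "continuous_on A f \<Longrightarrow> continuous_on A (\<lambda>x. cosh_mult m (f x))"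
  by (rule continuous_on_compose2[of UNIV "cosh_mult m" A f])
    (auto intro!: continuous_on_vector_derivative cosh_mult_has_vector_derivative)

text \<open>This addition theorem separates the variables of the kernel, so that
  \<open>Q_op\<close>, applied to functions vanishing near 0, becomes a combination of two integrals
  with variable upper limit.\<close>

lemma sinh_div_diff:
  "sinh_div m (u - v) = sinh_div m u * cosh_mult m v - cosh_mult m u * sinh_div m v"
  by (auto simp: sinh_div_def cosh_mult_def sinh_diff algebra_simps diff_divide_distrib)

lemma norm_exp_mult_le:
  assumes "u \<ge> 0"
  shows "norm (exp (m * of_real u)) \<le> exp (\<bar>Re m\<bar> * u)" "norm (exp (- (m * of_real u))) \<le> exp (\<bar>Re m\<bar> * u)"
proof -
  have "Re m * u \<le> \<bar>Re m\<bar> * u" "- (Re m * u) \<le> \<bar>Re m\<bar> * u"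
    using mult_right_mono[OF abs_ge_self assms, of "Re m"] mult_right_mono[OF abs_ge_minus_self assms, of "Re m"] by auto
  then show "norm (exp (m * of_real u)) \<le> exp (\<bar>Re m\<bar> * u)" "norm (exp (- (m * of_real u))) \<le> exp (\<bar>Re m\<bar> * u)"
    by (simp_all add: norm_exp_eq_Re)
qed

text \<open>Here the hypothesis on the real part turns into a rate \<open>\<rho> < 1\<close>. This
  strict inequality makes the kernel square integrable near \<open>y = 0\<close>, makes
  \<open>w\<close> and \<open>w'\<close> decay at infinity, and kills the boundary term at 0 in the
  lower bound.\<close>

lemma sinh_cosh_growth:
  assumes "\<bar>Re m\<bar> < 1"
  obtains c \<rho> where "c > 0" "0 < \<rho>" "\<rho> < 1"
    "\<And>u. u \<ge> 0 \<Longrightarrow> norm (sinh_div m u) \<le> c * exp (\<rho> * u)"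
    "\<And>u. u \<ge> 0 \<Longrightarrow> norm (cosh_mult m u) \<le> c * exp (\<rho> * u)"
proof -
  \<comment> \<open>The floor \<open>1/2\<close> keeps the rate positive even for purely imaginary
    \<open>m\<close>, so that at \<open>m = 0\<close> the linear function \<open>u\<close> is
    absorbed by \<open>2 * exp (\<rho> * u)\<close>. In \<open>c\<close>, the summand
    \<open>2\<close> serves that case and \<open>inverse (norm m)\<close> the denominator of
    \<open>sinh_div\<close> otherwise.\<close>
  define \<rho> where "\<rho> = max (1/2) \<bar>Re m\<bar>"
  define c where "c = 2 + inverse (norm m)"
  have \<rho>: "0 < \<rho>" "\<rho> < 1" "1/2 \<le> \<rho>" "\<bar>Re m\<bar> \<le> \<rho>" using assms by (auto simp: \<rho>_def)
  have c: "c > 0" "2 \<le> c" "inverse (norm m) \<le> c" by (auto simp: c_def intro: add_pos_nonneg)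
  have *: "norm (exp (m * of_real u)) \<le> exp (\<rho> * u)" "norm (exp (- (m * of_real u))) \<le> exp (\<rho> * u)" if "u \<ge> 0" for u
    using norm_exp_mult_le[OF that, of m] mult_right_mono[OF \<rho>(4) that]
    by (auto intro: order_trans)
  have sc: "norm (sinh (m * of_real u)) \<le> exp (\<rho> * u)" "norm (cosh (m * of_real u)) \<le> exp (\<rho> * u)" if "u \<ge> 0" for u
    unfolding sinh_field_def cosh_field_def norm_divide
    using norm_triangle_le_diff[OF add_mono[OF *[OF that]]] norm_triangle_le[OF add_mono[OF *[OF that]]]
    by simp_all
  show ?thesis
  proof (rule that[of c \<rho>])
    fix u :: real assume u: "u \<ge> 0"
    have "norm (cosh_mult m u) \<le> 1 * exp (\<rho> * u)" using sc(2)[OF u] by (simp add: cosh_mult_def)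
    also have "\<dots> \<le> c * exp (\<rho> * u)" using c by (intro mult_right_mono) auto
    finally show "norm (cosh_mult m u) \<le> c * exp (\<rho> * u)" .
    show "norm (sinh_div m u) \<le> c * exp (\<rho> * u)"
    proof (cases "m = 0")
      case True
      have "u \<le> 2 * (1 + \<rho> * u)" using mult_right_mono[OF \<rho>(3) u] by simp
      also have "\<dots> \<le> 2 * exp (\<rho> * u)" by (intro mult_left_mono exp_ge_add_one_self) auto
      also have "\<dots> \<le> c * exp (\<rho> * u)" using c by (intro mult_right_mono) auto
      finally show ?thesis using True u by (simp add: sinh_div_def)
    next
      case False
      then have "norm (sinh_div m u) = inverse (norm m) * norm (sinh (m * of_real u))"
        by (simp add: sinh_div_def norm_mult norm_inverse divide_inverse_commute)
      also have "\<dots> \<le> c * exp (\<rho> * u)" using c sc(1)[OF u] by (intro mult_mono) auto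
      finally show ?thesis .
    qed
  qed (use \<rho> c in auto)
qed

lemma complex_powr_of_real:
  "x > 0 \<Longrightarrow> complex_of_real x powr z = exp (z * of_real (ln x))"
  by (simp add: powr_def Ln_of_real)

text \<open>Pulling out the weights \<open>x powr (-3/2)\<close> and \<open>y powr (1/2)\<close>
  leaves a function of \<open>ln x - ln y\<close>, that is, a convolution kernel in logarithmic
  coordinates. Both cases of the definition of the kernel merge here.\<close>

lemma Q_kernel_eq:
  assumes "x > 0" "y > 0"
  shows "Q_kernel \<alpha> x y =
    (if y \<le> x then of_real (x powr (-3/2) * y powr (1/2)) * sinh_div (csqrt \<alpha>) (ln x - ln y) else 0)"
proof (cases "\<alpha> = 0")
  case True
  then show ?thesis using assms
    by (simp add: Q_kernel_def heaviside_def sinh_div_def ln_div powr_of_real[symmetric] del: powr_of_real)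
next
  case False
  define m where "m = csqrt \<alpha>"
  have m: "m \<noteq> 0" using False by (simp add: m_def)
  define a where "a = complex_of_real (ln x)"
  define b where "b = complex_of_real (ln y)"
  have 1: "complex_of_real (x powr (-3/2) * y powr (1/2)) = exp (-3/2 * a) * exp (1/2 * b)"
    using assms by (simp add: powr_def a_def b_def exp_of_real[symmetric] of_real_exp[symmetric])
  have 2: "1 / (2 * m) * (exp ((-3/2 + m) * a) * exp ((1/2 - m) * b) - exp ((-3/2 - m) * a) * exp ((1/2 + m) * b))
     = exp (-3/2 * a) * exp (1/2 * b) * (sinh (m * (a - b)) / m)"
  proof -
    have "exp ((-3/2 + m) * a) * exp ((1/2 - m) * b) = exp (-3/2 * a) * exp (1/2 * b) * exp (m * (a - b))"
      "exp ((-3/2 - m) * a) * exp ((1/2 + m) * b) = exp (-3/2 * a) * exp (1/2 * b) * exp (- (m * (a - b)))"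
      unfolding exp_add[symmetric] by (simp_all add: algebra_simps)
    then show ?thesis unfolding sinh_field_def by (simp only: right_diff_distrib[symmetric]) simp
  qed
  show ?thesis
  proof (cases "y \<le> x")
    case True
    have "Q_kernel \<alpha> x y = 1 / (2 * m) * (exp ((-3/2 + m) * a) * exp ((1/2 - m) * b) - exp ((-3/2 - m) * a) * exp ((1/2 + m) * b))"
      using assms False True unfolding Q_kernel_def Let_def m_def[symmetric]
      by (simp add: complex_powr_of_real a_def b_def heaviside_def)
    then show ?thesis
      unfolding 1 2 using True m by (simp add: sinh_div_def m_def a_def b_def)
  qed (simp add: Q_kernel_def Let_def heaviside_def)
qed

section \<open>Square-integrable functions on the half-line\<close>

lemma L2_posI:
  assumes "g \<in> borel_measurable pos_lebesgue" "integrable pos_lebesgue (\<lambda>x. (cmod (g x))\<^sup>2)"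
  shows "g \<in> L2_pos"
  using assms by (simp add: L2_pos_def)

lemma L2_posD:
  assumes "g \<in> L2_pos"
  shows "g \<in> borel_measurable pos_lebesgue" "integrable pos_lebesgue (\<lambda>x. (cmod (g x))\<^sup>2)"
  using assms by (simp_all add: L2_pos_def)

lemma L2_norm_nonneg: "L2_norm g \<ge> 0"
  by (simp add: L2_norm_def)

lemma L2_norm_power2: "(L2_norm g)\<^sup>2 = (\<integral>x. (cmod (g x))\<^sup>2 \<partial>pos_lebesgue)"
  by (simp add: L2_norm_def)

lemma L2_pos_bound:
  assumes f: "f \<in> L2_pos" and g: "g \<in> borel_measurable pos_lebesgue"
    and le: "\<And>x. x > 0 \<Longrightarrow> cmod (g x) \<le> C * cmod (f x)" and "C \<ge> 0"
  shows "g \<in> L2_pos" "L2_norm g \<le> C * L2_norm f"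
proof -
  have le2: "(cmod (g x))\<^sup>2 \<le> C\<^sup>2 * (cmod (f x))\<^sup>2" if "x > 0" for x
    using power_mono[OF le[OF that], of 2] by (simp add: power_mult_distrib)
  have int: "integrable pos_lebesgue (\<lambda>x. C\<^sup>2 * (cmod (f x))\<^sup>2)" using L2_posD(2)[OF f] by simp
  have gi: "integrable pos_lebesgue (\<lambda>x. (cmod (g x))\<^sup>2)"
    by (rule Bochner_Integration.integrable_bound[OF int])
      (use g le2 in \<open>auto intro!: AE_I2 simp: space_restrict_space\<close>)
  then show "g \<in> L2_pos" using g by (simp add: L2_pos_def)
  have "(L2_norm g)\<^sup>2 \<le> (C * L2_norm f)\<^sup>2"
    unfolding power_mult_distrib L2_norm_power2 Bochner_Integration.integral_mult_right_zero[symmetric]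
    by (rule integral_mono[OF gi int]) (use le2 in \<open>auto simp: space_restrict_space\<close>)
  then show "L2_norm g \<le> C * L2_norm f"
    using \<open>C \<ge> 0\<close> L2_norm_nonneg by (auto intro: power2_le_imp_le)
qed

lemma L2_pos_integrable_mult:
  assumes "f \<in> L2_pos" "g \<in> L2_pos"
  shows "integrable pos_lebesgue (\<lambda>x. f x * g x)"
proof (rule Bochner_Integration.integrable_bound)
  show "integrable pos_lebesgue (\<lambda>x. (cmod (f x))\<^sup>2 + (cmod (g x))\<^sup>2)"
    using assms by (simp add: L2_posD)
  show "(\<lambda>x. f x * g x) \<in> borel_measurable pos_lebesgue"
    using assms[THEN L2_posD(1)] by measurable
  have "a * b \<le> a\<^sup>2 + b\<^sup>2" if "a \<ge> 0" "b \<ge> 0" for a b :: real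
    using sum_squares_bound[of a b] that mult_nonneg_nonneg[OF that] by linarith
  then show "AE x in pos_lebesgue. norm (f x * g x) \<le> norm ((cmod (f x))\<^sup>2 + (cmod (g x))\<^sup>2)"
    by (auto simp: norm_mult)
qed

lemma L2_pos_Cauchy_Schwarz:
  assumes f: "f \<in> L2_pos" and g: "g \<in> L2_pos"
  shows "(\<integral>x. cmod (f x * g x) \<partial>pos_lebesgue) \<le> L2_norm f * L2_norm g"
proof -
  have [measurable]: "f \<in> borel_measurable pos_lebesgue" "g \<in> borel_measurable pos_lebesgue"
    using assms[THEN L2_posD(1)] .
  have nn: "(\<integral>\<^sup>+x. (ennreal (cmod (h x)))\<^sup>2 \<partial>pos_lebesgue) = ennreal ((L2_norm h)\<^sup>2)" if "h \<in> L2_pos" for h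
    unfolding L2_norm_power2
    by (subst nn_integral_eq_integral[symmetric]) (use that in \<open>auto simp: L2_posD ennreal_power\<close>)
  have fg: "integrable pos_lebesgue (\<lambda>x. cmod (f x * g x))"
    using L2_pos_integrable_mult[OF assms] by simp
  have eq: "(\<integral>\<^sup>+x. ennreal (cmod (f x)) * ennreal (cmod (g x)) \<partial>pos_lebesgue) =
      ennreal (\<integral>x. cmod (f x * g x) \<partial>pos_lebesgue)"
    by (subst nn_integral_eq_integral[symmetric]) (use fg in \<open>auto simp: norm_mult ennreal_mult\<close>)
  have "ennreal ((\<integral>x. cmod (f x * g x) \<partial>pos_lebesgue)\<^sup>2) \<le> ennreal ((L2_norm f * L2_norm g)\<^sup>2)"
    using Cauchy_Schwarz_nn_integral[of "\<lambda>x. ennreal (cmod (f x))" pos_lebesgue "\<lambda>x. ennreal (cmod (g x))"]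
    unfolding eq nn[OF f] nn[OF g]
    by (simp add: ennreal_power ennreal_mult[symmetric] power_mult_distrib)
  then have "(\<integral>x. cmod (f x * g x) \<partial>pos_lebesgue)\<^sup>2 \<le> (L2_norm f * L2_norm g)\<^sup>2"
    by (subst (asm) ennreal_le_iff) simp_all
  then show ?thesis
    by (rule power2_le_imp_le) (simp add: L2_norm_nonneg)
qed

lemma L2_pos_integral_mult_le:
  assumes "f \<in> L2_pos" "g \<in> L2_pos"
  shows "cmod (\<integral>x. f x * g x \<partial>pos_lebesgue) \<le> L2_norm f * L2_norm g"
  by (rule order_trans[OF integral_norm_bound L2_pos_Cauchy_Schwarz[OF assms]])

lemma L2_pos_add:
  assumes f: "f \<in> L2_pos" and g: "g \<in> L2_pos"
  shows "(\<lambda>x. f x + g x) \<in> L2_pos" "L2_norm (\<lambda>x. f x + g x) \<le> L2_norm f + L2_norm g"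
proof -
  have [measurable]: "f \<in> borel_measurable pos_lebesgue" "g \<in> borel_measurable pos_lebesgue"
    using assms[THEN L2_posD(1)] .
  have i: "integrable pos_lebesgue (\<lambda>x. (cmod (f x))\<^sup>2)" "integrable pos_lebesgue (\<lambda>x. (cmod (g x))\<^sup>2)"
    "integrable pos_lebesgue (\<lambda>x. cmod (f x * g x))"
    using L2_posD(2)[OF f] L2_posD(2)[OF g] L2_pos_integrable_mult[OF f g] by simp_all
  let ?b = "\<lambda>x. (cmod (f x))\<^sup>2 + 2 * cmod (f x * g x) + (cmod (g x))\<^sup>2"
  have le: "(cmod (f x + g x))\<^sup>2 \<le> ?b x" for x
    using power_mono[OF norm_triangle_ineq[of "f x" "g x"], of 2] by (simp add: power2_sum norm_mult)
  have int: "integrable pos_lebesgue ?b" using i by (intro Bochner_Integration.integrable_add) auto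
  have fi: "integrable pos_lebesgue (\<lambda>x. (cmod (f x + g x))\<^sup>2)"
    by (rule Bochner_Integration.integrable_bound[OF int])
      (use le in \<open>auto intro!: AE_I2 intro: order_trans abs_ge_self\<close>)
  then show "(\<lambda>x. f x + g x) \<in> L2_pos" by (simp add: L2_pos_def)
  have "(L2_norm (\<lambda>x. f x + g x))\<^sup>2 \<le> (\<integral>x. ?b x \<partial>pos_lebesgue)"
    unfolding L2_norm_power2 by (rule integral_mono[OF fi int]) (rule le)
  also have "\<dots> = (L2_norm f)\<^sup>2 + 2 * (\<integral>x. cmod (f x * g x) \<partial>pos_lebesgue) + (L2_norm g)\<^sup>2"
    using i unfolding L2_norm_power2 by simp
  also have "\<dots> \<le> (L2_norm f + L2_norm g)\<^sup>2"
    using L2_pos_Cauchy_Schwarz[OF f g] by (simp add: power2_sum)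
  finally show "L2_norm (\<lambda>x. f x + g x) \<le> L2_norm f + L2_norm g"
    by (rule power2_le_imp_le) (simp add: L2_norm_nonneg)
qed

lemma L2_pos_cmult:
  assumes "g \<in> L2_pos"
  shows "(\<lambda>x. c * g x) \<in> L2_pos" "L2_norm (\<lambda>x. c * g x) = cmod c * L2_norm g"
proof -
  have eq: "(\<lambda>x. (cmod (c * g x))\<^sup>2) = (\<lambda>x. (cmod c)\<^sup>2 * (cmod (g x))\<^sup>2)"
    by (simp add: norm_mult power_mult_distrib)
  have "(\<lambda>x. c * g x) \<in> borel_measurable pos_lebesgue" using L2_posD(1)[OF assms] by measurable
  then show "(\<lambda>x. c * g x) \<in> L2_pos"
    unfolding L2_pos_def mem_Collect_eq eq using L2_posD(2)[OF assms] by simp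
  show "L2_norm (\<lambda>x. c * g x) = cmod c * L2_norm g"
    unfolding L2_norm_def eq by (simp add: real_sqrt_mult)
qed

lemma L2_pos_diff:
  assumes f: "f \<in> L2_pos" and g: "g \<in> L2_pos"
  shows "(\<lambda>x. f x - g x) \<in> L2_pos"
  using L2_pos_add(1)[OF f L2_pos_cmult(1)[OF g, of "-1"]] by simp

text \<open>The bounds \<open>c n\<close> may vary with \<open>n\<close>, which leaves room for
  error terms that vanish in the limit, such as boundary terms or approximation errors.\<close>

lemma Fatou_integrable:
  fixes F :: "nat \<Rightarrow> 'a \<Rightarrow> real"
  assumes F: "\<And>n. integrable M (F n)" and nonneg: "\<And>n x. x \<in> space M \<Longrightarrow> F n x \<ge> 0"
    and lim: "\<And>x. x \<in> space M \<Longrightarrow> (\<lambda>n. F n x) \<longlonglongrightarrow> f x"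
    and c: "\<And>n. (\<integral>x. F n x \<partial>M) \<le> c n" "c \<longlonglongrightarrow> C"
  shows "integrable M f" "(\<integral>x. f x \<partial>M) \<le> C"
proof -
  have meas [measurable]: "f \<in> borel_measurable M"
    by (rule borel_measurable_LIMSEQ_real[OF lim]) (use F in auto)
  have [measurable]: "F n \<in> borel_measurable M" for n using F by auto
  have f0: "f x \<ge> 0" if "x \<in> space M" for x
    by (rule LIMSEQ_le_const[OF lim[OF that]]) (use nonneg[OF that] in auto)
  have c0: "c n \<ge> 0" for n
    by (rule order_trans[OF Bochner_Integration.integral_nonneg c(1)]) (rule nonneg)
  have C0: "C \<ge> 0" by (rule LIMSEQ_le_const[OF c(2)]) (use c0 in auto)
  have "(\<integral>\<^sup>+x. ennreal (f x) \<partial>M) = (\<integral>\<^sup>+x. liminf (\<lambda>n. ennreal (F n x)) \<partial>M)"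
    by (intro nn_integral_cong lim_imp_Liminf[symmetric] tendsto_ennrealI lim) auto
  also have "\<dots> \<le> liminf (\<lambda>n. \<integral>\<^sup>+x. ennreal (F n x) \<partial>M)"
    by (rule nn_integral_liminf) auto
  also have "\<dots> \<le> liminf (\<lambda>n. ennreal (c n))"
  proof (rule Liminf_mono, rule always_eventually, rule allI)
    fix n
    have "(\<integral>\<^sup>+x. ennreal (F n x) \<partial>M) = ennreal (\<integral>x. F n x \<partial>M)"
      by (rule nn_integral_eq_integral[OF F]) (use nonneg in auto)
    also have "\<dots> \<le> ennreal (c n)" using c(1) by (rule ennreal_leI)
    finally show "(\<integral>\<^sup>+x. ennreal (F n x) \<partial>M) \<le> ennreal (c n)" .
  qed
  also have "\<dots> = ennreal C"
    by (intro lim_imp_Liminf tendsto_ennrealI c(2)) auto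
  finally have le: "(\<integral>\<^sup>+x. ennreal (f x) \<partial>M) \<le> ennreal C" .
  show int: "integrable M f"
  proof (rule integrableI_nonneg[OF meas])
    show "AE x in M. 0 \<le> f x" using f0 by (intro AE_I2) auto
    show "(\<integral>\<^sup>+x. ennreal (f x) \<partial>M) < \<infinity>" by (rule le_less_trans[OF le]) simp
  qed
  have "ennreal (\<integral>x. f x \<partial>M) \<le> ennreal C"
    by (rule order_trans[OF eq_refl[OF nn_integral_eq_integral[OF int, symmetric]] le]) (use f0 in auto)
  then show "(\<integral>x. f x \<partial>M) \<le> C" using C0 by simp
qed

lemma borel_measurable_pos_lebesgue_continuous:
  "continuous_on {0<..} f \<Longrightarrow> f \<in> borel_measurable pos_lebesgue"
  by (rule continuous_imp_measurable_on_sets_lebesgue) auto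

lemma borel_measurable_pos_lebesgue_id [measurable]: "(\<lambda>x. x) \<in> borel_measurable pos_lebesgue"
  by (rule borel_measurable_pos_lebesgue_continuous) (rule continuous_on_id)

lemma integrable_powr_pos_lebesgue:
  fixes p :: real
  assumes "p > -1" "b \<ge> 0"
  shows "integrable pos_lebesgue (\<lambda>y. if y \<le> b then y powr p else 0)"
proof -
  have "set_integrable lebesgue {0..b} (\<lambda>y. y powr p)"
    using assms by (intro nonnegative_absolutely_integrable_1 integrable_on_powr_from_0) auto
  then have "set_integrable lebesgue {0<..b} (\<lambda>y. y powr p)"
    by (rule set_integrable_subset) auto
  moreover have "indicator {0<..b} y *\<^sub>R y powr p = indicator {0<..} y *\<^sub>R (if y \<le> b then y powr p else 0)" for y
    by (auto simp: indicator_def)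
  ultimately show ?thesis
    by (subst integrable_restrict_space) (simp_all add: set_integrable_def)
qed

text \<open>The kernel vanishes for \<open>y > x\<close>, and its square is at most a multiple of
  \<open>y powr (1 - 2 * \<rho>)\<close>, whose exponent exceeds -1. Hence the integral defining
  \<open>Q_op \<alpha> g x\<close> converges absolutely for every \<open>x > 0\<close> and depends
  continuously on \<open>g\<close> in the norm.\<close>

lemma Q_kernel_L2_pos:
  assumes \<alpha>: "\<bar>Re (csqrt \<alpha>)\<bar> < 1" and x: "x > 0"
  shows "(\<lambda>y. Q_kernel \<alpha> x y) \<in> L2_pos"
proof -
  obtain c \<rho> where c: "c > 0" "0 < \<rho>" "\<rho> < 1"
    and bound: "\<And>u. u \<ge> 0 \<Longrightarrow> norm (sinh_div (csqrt \<alpha>) u) \<le> c * exp (\<rho> * u)"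
    using sinh_cosh_growth[OF \<alpha>] by metis
  define F where "F = (\<lambda>y. of_real (x powr (-3/2) * y powr (1/2)) * sinh_div (csqrt \<alpha>) (ln x - ln y))"
  define D where "D = x powr (-3/2) * c * x powr \<rho>"
  have eq: "Q_kernel \<alpha> x y = (if y \<le> x then F y else 0)" if "y > 0" for y
    using Q_kernel_eq[OF x that] by (simp add: F_def)
  have [measurable]: "F \<in> borel_measurable pos_lebesgue"
    unfolding F_def by (rule borel_measurable_pos_lebesgue_continuous) (auto intro!: continuous_intros)
  have "(\<lambda>y. if y \<le> x then F y else 0) \<in> borel_measurable pos_lebesgue" by measurable
  then have meas: "(\<lambda>y. Q_kernel \<alpha> x y) \<in> borel_measurable pos_lebesgue"
    by (rule measurable_cong[THEN iffD1, rotated]) (simp add: eq space_restrict_space)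
  have F_le: "(cmod (F y))\<^sup>2 \<le> D\<^sup>2 * y powr (1 - 2 * \<rho>)" if y: "0 < y" "y \<le> x" for y
  proof -
    have "exp (\<rho> * (ln x - ln y)) = x powr \<rho> * y powr (-\<rho>)"
      using x y by (simp add: powr_def exp_add[symmetric] algebra_simps)
    then have "cmod (F y) \<le> x powr (-3/2) * y powr (1/2) * (c * (x powr \<rho> * y powr (-\<rho>)))"
      using bound[of "ln x - ln y"] x y by (auto simp: F_def norm_mult intro!: mult_left_mono)
    also have "\<dots> = D * y powr (1/2 - \<rho>)"
    proof -
      have "y powr (1/2 - \<rho>) = y powr (1/2) * y powr (- \<rho>)" by (simp flip: powr_add)
      then show ?thesis by (simp add: D_def mult_ac)
    qed
    finally have "(cmod (F y))\<^sup>2 \<le> (D * y powr (1/2 - \<rho>))\<^sup>2" by (rule power_mono) simp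
    also have "\<dots> = D\<^sup>2 * y powr (1 - 2 * \<rho>)"
      using y by (simp add: power_mult_distrib powr_power algebra_simps)
    finally show ?thesis .
  qed
  have "integrable pos_lebesgue (\<lambda>y. (cmod (Q_kernel \<alpha> x y))\<^sup>2)"
  proof (rule Bochner_Integration.integrable_bound)
    show "integrable pos_lebesgue (\<lambda>y. D\<^sup>2 * (if y \<le> x then y powr (1 - 2 * \<rho>) else 0))"
      using c x by (intro Bochner_Integration.integrable_mult_right integrable_powr_pos_lebesgue) auto
    show "(\<lambda>y. (cmod (Q_kernel \<alpha> x y))\<^sup>2) \<in> borel_measurable pos_lebesgue"
      using meas by measurable
    show "AE y in pos_lebesgue. norm ((cmod (Q_kernel \<alpha> x y))\<^sup>2) \<le> norm (D\<^sup>2 * (if y \<le> x then y powr (1 - 2 * \<rho>) else 0))"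
      using F_le by (intro AE_I2) (auto simp: space_restrict_space eq)
  qed
  with meas show ?thesis by (rule L2_posI)
qed

text \<open>Bridge from the Lebesgue integral on the half-line to the gauge integral on a compact
  interval, for which the fundamental theorem of calculus is available.\<close>

lemma
  fixes k :: "real \<Rightarrow> 'b::euclidean_space"
  assumes k: "continuous_on {a..r} k" and a: "0 < a"
  shows integrable_pos_lebesgue_compact: "integrable pos_lebesgue (\<lambda>x. if x \<in> {a..r} then k x else 0)"
    and integral_pos_lebesgue_compact: "(\<integral>x. (if x \<in> {a..r} then k x else 0) \<partial>pos_lebesgue) = integral {a..r} k"
proof -
  have "set_integrable lebesgue {a..r} k"
    by (rule absolutely_integrable_continuous_real[OF k])
  moreover have "indicator {a..r} x *\<^sub>R k x = indicator {0<..} x *\<^sub>R (if x \<in> {a..r} then k x else 0)" for x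
    using a by (auto simp: indicator_def)
  ultimately show int: "integrable pos_lebesgue (\<lambda>x. if x \<in> {a..r} then k x else 0)"
    by (subst integrable_restrict_space) (simp_all add: set_integrable_def)
  have "(\<integral>x. (if x \<in> {a..r} then k x else 0) \<partial>pos_lebesgue) = integral {0<..} (\<lambda>x. if x \<in> {a..r} then k x else 0)"
    by (rule lebesgue_integral_eq_integral[OF int]) auto
  also have "\<dots> = integral ({a..r} \<inter> {0<..}) k"
    by (rule Henstock_Kurzweil_Integration.integral_restrict_Int)
  also have "{a..r} \<inter> {0<..} = {a..r}" using a by auto
  finally show "(\<integral>x. (if x \<in> {a..r} then k x else 0) \<partial>pos_lebesgue) = integral {a..r} k" .
qed

section \<open>Density of continuous functions with compact support in the open half-line\<close>

lemma L2_norm_diff_tendsto_0: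
  assumes h: "h \<in> L2_pos" and f: "\<And>n. f n \<in> borel_measurable pos_lebesgue" and F: "F \<in> borel_measurable pos_lebesgue"
    and lim: "AE x in pos_lebesgue. (\<lambda>n. f n x) \<longlonglongrightarrow> F x"
    and le: "\<And>n x. x > 0 \<Longrightarrow> cmod (F x - f n x) \<le> cmod (h x)"
  shows "(\<lambda>n. L2_norm (\<lambda>x. F x - f n x)) \<longlonglongrightarrow> 0"
proof -
  note [measurable] = f F
  have "(\<lambda>n. \<integral>x. (cmod (F x - f n x))\<^sup>2 \<partial>pos_lebesgue) \<longlonglongrightarrow> (\<integral>x. 0 \<partial>pos_lebesgue)"
  proof (rule integral_dominated_convergence)
    show "integrable pos_lebesgue (\<lambda>x. (cmod (h x))\<^sup>2)" by (rule L2_posD(2)[OF h])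
    show "AE x in pos_lebesgue. (\<lambda>n. (cmod (F x - f n x))\<^sup>2) \<longlonglongrightarrow> 0"
      using lim
    proof eventually_elim
      case (elim x)
      have "(\<lambda>n. (cmod (F x - f n x))\<^sup>2) \<longlonglongrightarrow> (cmod (F x - F x))\<^sup>2"
        by (intro tendsto_intros elim)
      then show ?case by simp
    qed
    show "AE x in pos_lebesgue. norm ((cmod (F x - f n x))\<^sup>2) \<le> (cmod (h x))\<^sup>2" for n
      using le by (intro AE_I2) (auto simp: space_restrict_space intro!: power_mono)
  qed simp_all
  then have "(\<lambda>n. sqrt (\<integral>x. (cmod (F x - f n x))\<^sup>2 \<partial>pos_lebesgue)) \<longlonglongrightarrow> sqrt 0"
    by (intro tendsto_real_sqrt) simp
  then show ?thesis by (simp add: L2_norm_def)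
qed

lemma L2_pos_approx_bounded:
  assumes g: "g \<in> L2_pos" and "e > 0"
  obtains G a b M where "G \<in> borel_measurable pos_lebesgue" "0 < a" "a < b" "0 < M"
    "\<And>y. y \<notin> {a..b} \<Longrightarrow> G y = 0" "\<And>y. cmod (G y) \<le> M" "L2_norm (\<lambda>y. g y - G y) < e"
proof -
  \<comment> \<open>Truncation in the argument and in the size. The offset \<open>2\<close> makes
    \<open>inverse (real (n + 2)) < real (n + 2)\<close> strict, as \<open>a < b\<close>
    demands.\<close>
  define G where "G = (\<lambda>n x. if inverse (real (n + 2)) \<le> x \<and> x \<le> real (n + 2) \<and> cmod (g x) \<le> real (n + 2) then g x else 0)"
  have [measurable]: "g \<in> borel_measurable pos_lebesgue" using L2_posD(1)[OF g] .
  have meas: "G n \<in> borel_measurable pos_lebesgue" for n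
    unfolding G_def by measurable
  have "(\<lambda>n. L2_norm (\<lambda>x. g x - G n x)) \<longlonglongrightarrow> 0"
  proof (rule L2_norm_diff_tendsto_0[OF g meas])
    show "AE x in pos_lebesgue. (\<lambda>n. G n x) \<longlonglongrightarrow> g x"
    proof (rule AE_I2, rule tendsto_eventually)
      fix x assume "x \<in> space pos_lebesgue"
      then have x: "x > 0" by (simp add: space_restrict_space)
      obtain N where N: "max (inverse x) (max x (cmod (g x))) \<le> real N" using real_arch_simple by blast
      show "\<forall>\<^sub>F n in sequentially. G n x = g x"
        using eventually_ge_at_top[of N]
      proof eventually_elim
        case (elim n)
        have n: "max (inverse x) (max x (cmod (g x))) \<le> real (n + 2)" using N elim by simp
        then have "inverse (real (n + 2)) \<le> inverse (inverse x)"
          using x by (intro le_imp_inverse_le) auto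
        then show ?case using n by (simp add: G_def)
      qed
    qed
  qed (auto simp: G_def)
  then have "\<forall>\<^sub>F n in sequentially. L2_norm (\<lambda>x. g x - G n x) < e"
    using \<open>e > 0\<close> by (rule order_tendstoD(2))
  then obtain n where n: "L2_norm (\<lambda>x. g x - G n x) < e"
    by (auto simp: eventually_sequentially)
  show ?thesis
  proof (rule that[OF meas[of n] _ _ _ _ _ n])
    show "inverse (real (n + 2)) < real (n + 2)"
      using less_imp_inverse_less[of 1 "real (n + 2)"] by simp
  qed (auto simp: G_def)
qed

text \<open>A truncated function \<open>G\<close> is measurable, hence an almost everywhere limit of
  continuous functions \<open>u k\<close>. These need be neither uniformly bounded nor compactly
  supported, which is repaired before the limit is taken.\<close>

lemma L2_pos_approx_continuous:
  assumes g: "g \<in> L2_pos" and e: "e > 0"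
  obtains \<phi> a b where "continuous_on UNIV \<phi>" "0 < a" "a < b" "\<And>y. y \<notin> {a..b} \<Longrightarrow> \<phi> y = 0"
    "L2_norm (\<lambda>y. g y - \<phi> y) < e" "\<phi> \<in> L2_pos"
proof -
  obtain G a b M where G: "G \<in> borel_measurable pos_lebesgue" and ab: "0 < a" "a < b" and M: "0 < M"
    and supp: "\<And>y. y \<notin> {a..b} \<Longrightarrow> G y = 0" and GM: "\<And>y. cmod (G y) \<le> M"
    and Ge: "L2_norm (\<lambda>y. g y - G y) < e / 2"
    using L2_pos_approx_bounded[OF g half_gt_zero[OF e]] by blast
  have "G measurable_on {0<..}"
    using G by (simp add: measurable_on_iff_borel_measurable)
  then obtain N u where N: "negligible N" and u: "\<And>k. continuous_on UNIV (u k)"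
    and lim: "\<And>x. x \<notin> N \<Longrightarrow> (\<lambda>k. u k x) \<longlonglongrightarrow> (if x \<in> {0<..} then G x else 0)"
    unfolding measurable_on_def by blast
  \<comment> \<open>Piecewise linear, equal to 1 on \<open>{a..b}\<close> and to 0 outside
    \<open>{a/2..2*b}\<close>, so the support stays away from 0.\<close>
  define cut :: "real \<Rightarrow> real" where "cut = (\<lambda>x. max 0 (min 1 (min (2 * x / a - 1) (2 - x / b))))"
  \<comment> \<open>Clipping and cutting off preserve the pointwise limit \<open>G\<close> and make dominated convergence applicable.\<close>
  define \<psi> where "\<psi> = (\<lambda>z. (M / max M (cmod z)) *\<^sub>R z)"
  define \<phi> where "\<phi> = (\<lambda>k x. cut x *\<^sub>R \<psi> (u k x))"
  \<comment> \<open>The dominating function: \<open>G\<close> and \<open>\<phi> k\<close> are both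
    bounded by \<open>M\<close>, hence their difference by \<open>2 * M\<close>.\<close>
  define h :: "real \<Rightarrow> complex" where "h = (\<lambda>x. if a/2 \<le> x \<and> x \<le> 2 * b then of_real (2 * M) else 0)"
  have cut0: "cut x = 0" if "x \<notin> {a/2..2*b}" for x
  proof -
    have "2 * x / a - 1 \<le> 0 \<or> 2 - x / b \<le> 0"
      using that ab by (auto simp: field_simps)
    then show ?thesis by (auto simp: cut_def)
  qed
  have cut1: "cut x = 1" if "x \<in> {a..b}" for x
  proof -
    have "2 * x / a - 1 \<ge> 1 \<and> 2 - x / b \<ge> 1"
      using that ab by (auto simp: field_simps)
    then show ?thesis by (auto simp: cut_def)
  qed
  have cut_le: "\<bar>cut x\<bar> \<le> 1" for x by (auto simp: cut_def)
  have \<psi>_le: "cmod (\<psi> z) \<le> M" for z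
    using M by (auto simp: \<psi>_def max_def field_simps)
  have \<psi>_id: "\<psi> z = z" if "cmod z \<le> M" for z
    using that M by (simp add: \<psi>_def max_def)
  have cont\<psi>: "continuous_on UNIV \<psi>"
    unfolding \<psi>_def using M by (intro continuous_intros) auto
  have cont\<phi>: "continuous_on UNIV (\<phi> k)" for k
    unfolding \<phi>_def
    by (intro continuous_on_scaleR continuous_on_compose2[OF cont\<psi> u])
      (auto simp: cut_def divide_inverse intro!: continuous_intros)
  have \<phi>_le: "cmod (\<phi> k x) \<le> M" for k x
    using mult_mono[OF cut_le[of x] \<psi>_le[of "u k x"]] by (simp add: \<phi>_def)
  have \<phi>0: "\<phi> k x = 0" if "x \<notin> {a/2..2*b}" for k x
    using cut0[OF that] by (simp add: \<phi>_def)
  have M2: "r \<le> 2 * M" if "r \<le> M" for r using that M by simp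
  have \<phi>_meas: "\<phi> k \<in> borel_measurable pos_lebesgue" for k
    by (intro borel_measurable_pos_lebesgue_continuous continuous_on_subset[OF cont\<phi>]) auto
  have h: "h \<in> L2_pos"
  proof (rule L2_posI)
    show "h \<in> borel_measurable pos_lebesgue" unfolding h_def by measurable
    have "integrable pos_lebesgue (\<lambda>x. if x \<in> {a/2..2*b} then (2 * M)\<^sup>2 else 0)"
      using ab by (intro integrable_pos_lebesgue_compact) auto
    moreover have "(if x \<in> {a/2..2*b} then (2 * M)\<^sup>2 else 0) = (cmod (h x))\<^sup>2" for x
      using M by (simp add: h_def)
    ultimately show "integrable pos_lebesgue (\<lambda>x. (cmod (h x))\<^sup>2)" by simp
  qed
  have \<phi>_L2: "\<phi> k \<in> L2_pos" for k
    by (rule L2_pos_bound(1)[OF h \<phi>_meas, where C = 1])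
      (use M2[OF \<phi>_le] \<phi>0 M in \<open>auto simp: h_def\<close>)
  have "(\<lambda>k. L2_norm (\<lambda>x. G x - \<phi> k x)) \<longlonglongrightarrow> 0"
  proof (rule L2_norm_diff_tendsto_0[OF h \<phi>_meas G])
    have "AE x in lebesgue. x \<notin> N"
      using N by (simp add: negligible_iff_null_sets AE_not_in)
    then have "AE x in pos_lebesgue. x \<notin> N"
      by (subst AE_restrict_space_iff) auto
    then show "AE x in pos_lebesgue. (\<lambda>k. \<phi> k x) \<longlonglongrightarrow> G x"
      using AE_space
    proof eventually_elim
      case (elim x)
      then have "(\<lambda>k. u k x) \<longlonglongrightarrow> G x" using lim[of x] by (simp add: space_restrict_space)
      then have "(\<lambda>k. \<phi> k x) \<longlonglongrightarrow> cut x *\<^sub>R \<psi> (G x)"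
        unfolding \<phi>_def using cont\<psi> by (intro tendsto_intros continuous_on_tendsto_compose[OF cont\<psi>]) auto
      moreover have "cut x *\<^sub>R \<psi> (G x) = G x"
        using cut1[of x] supp[of x] \<psi>_id[OF GM[of x]] by (cases "x \<in> {a..b}") auto
      ultimately show ?case by simp
    qed
    fix k x
    show "cmod (G x - \<phi> k x) \<le> cmod (h x)"
    proof (cases "x \<in> {a/2..2*b}")
      case True
      then show ?thesis
        using norm_triangle_ineq4[of "G x" "\<phi> k x"] GM[of x] \<phi>_le[of k x] M by (simp add: h_def)
    next
      case False
      then have "G x = 0" using ab by (intro supp) auto
      then show ?thesis using \<phi>0[OF False] by simp
    qed
  qed
  then have "\<forall>\<^sub>F k in sequentially. L2_norm (\<lambda>x. G x - \<phi> k x) < e / 2"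
    using e by (intro order_tendstoD(2)) auto
  then obtain k where k: "L2_norm (\<lambda>x. G x - \<phi> k x) < e / 2"
    by (auto simp: eventually_sequentially)
  have G_L2: "G \<in> L2_pos"
    by (rule L2_pos_bound(1)[OF h G, where C = 1])
      (use M2[OF GM] supp M ab in \<open>auto simp: h_def\<close>)
  have "L2_norm (\<lambda>y. (g y - G y) + (G y - \<phi> k y)) \<le> L2_norm (\<lambda>y. g y - G y) + L2_norm (\<lambda>y. G y - \<phi> k y)"
    by (intro L2_pos_add(2) L2_pos_diff g G_L2 \<phi>_L2)
  then have "L2_norm (\<lambda>y. g y - \<phi> k y) < e" using k Ge by simp
  with cont\<phi> \<phi>0 \<phi>_L2 show ?thesis
    using ab by (intro that[of "\<phi> k" "a/2" "2*b"]) auto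
qed

section \<open>The upper bound\<close>

text \<open>Here \<open>w\<close>, \<open>v\<close>, \<open>u\<close> stand for \<open>w\<close>, \<open>w'\<close>, \<open>w''\<close>; the left-hand side is the derivative of the form \<open>B\<close>
  used in \<open>Q_op_compact_support_estimate\<close>. The assumptions say that \<open>\<bar>p\<bar>\<^sup>2\<close> is critical at \<open>\<omega>\<close> with value \<open>d\<^sup>2\<close>
  and that \<open>\<bar>p(t)\<bar>\<^sup>2 - d\<^sup>2 = (t - \<omega>)\<^sup>2 ((t + \<omega>)\<^sup>2 + \<gamma>\<^sup>2)\<close>.\<close>

lemma energy_identity:
  fixes w v u :: complex and \<omega> \<gamma> :: real
  assumes \<gamma>: "\<gamma>\<^sup>2 = 4 - 2 * b1 + 2 * \<omega>\<^sup>2" and b2: "b2 = \<omega> * (b1 - \<omega>\<^sup>2) - 2 * \<omega>"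
    and d: "d\<^sup>2 = (b1 - \<omega>\<^sup>2)\<^sup>2 + (b2 + 2 * \<omega>)\<^sup>2"
  shows "(2 - \<gamma>) * (2 * (u \<bullet> v)) + 2 * (b1 - \<omega>\<^sup>2) * (u \<bullet> w + v \<bullet> v) + 2 * (b2 + \<gamma> * \<omega>) * ((- \<i> * u) \<bullet> w)
     + (2 * b1 - \<gamma> * \<omega>\<^sup>2) * (2 * (v \<bullet> w))
   = (cmod (u + 2 * v + Complex b1 b2 * w))\<^sup>2 - d\<^sup>2 * (cmod w)\<^sup>2
     - (cmod (u + of_real \<gamma> * v + Complex (\<omega>\<^sup>2) (- \<gamma> * \<omega>) * w))\<^sup>2"
proof -
  \<comment> \<open>Solving for \<open>b1\<close> keeps the identity polynomial: after eliminating
    \<open>d\<^sup>2\<close>, \<open>b2\<close> and \<open>b1\<close>, only \<open>\<omega>\<close>,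
    \<open>\<gamma>\<close> and the real and imaginary parts of \<open>w\<close>, \<open>v\<close>,
    \<open>u\<close> remain.\<close>
  have b1: "b1 = (4 + 2 * \<omega>\<^sup>2 - \<gamma>\<^sup>2) / 2" using \<gamma> by simp
  show ?thesis
    unfolding d b2 b1 cmod_power2 inner_complex_def
    by (simp add: power2_eq_square algebra_simps) (simp add: field_simps)
qed

text \<open>The Wronskian of the two solutions \<open>cosh_mult m\<close> and
  \<open>sinh_div m\<close>. Its value 1 is the coefficient with which the source reappears in the
  differential equation for \<open>w\<close>.\<close>

lemma cosh_sinh_div_identity: "(cosh_mult m u)\<^sup>2 - m\<^sup>2 * (sinh_div m u)\<^sup>2 = 1"
  using hyperbolic_pythagoras[of "m * of_real u"]
  by (cases "m = 0") (simp_all add: cosh_mult_def sinh_div_def power_divide)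

lemma has_vector_derivative_compose_ln:
  fixes f :: "real \<Rightarrow> complex"
  assumes "\<And>s. (f has_vector_derivative f' s) (at s)" and x: "x > 0"
  shows "((\<lambda>x. f (ln x)) has_vector_derivative f' (ln x) / of_real x) (at x within A)"
proof -
  have "(ln has_vector_derivative 1 / x) (at x within A)"
    using x by (auto intro!: derivative_eq_intros has_vector_derivative_at_within
      simp: has_real_derivative_iff_has_vector_derivative[symmetric] field_simps)
  from vector_diff_chain_within[OF this has_vector_derivative_at_within[OF assms(1)]]
  show ?thesis by (simp add: o_def scaleR_conv_of_real)
qed

text \<open>The variation of constants formula, obtained from the addition theorem. For
  \<open>x < a\<close> the interval is empty and both sides are 0.\<close>

lemma Q_op_compact_support_eq:
  assumes \<phi>: "continuous_on UNIV \<phi>" and a: "0 < a" and supp: "\<And>y. y < a \<Longrightarrow> \<phi> y = 0" and x: "x > 0"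
  shows "Q_op \<alpha> \<phi> x = of_real (x powr (-3/2)) *
     (sinh_div (csqrt \<alpha>) (ln x) * integral {a..x} (\<lambda>y. of_real (y powr (1/2)) * cosh_mult (csqrt \<alpha>) (ln y) * \<phi> y)
      - cosh_mult (csqrt \<alpha>) (ln x) * integral {a..x} (\<lambda>y. of_real (y powr (1/2)) * sinh_div (csqrt \<alpha>) (ln y) * \<phi> y))"
proof -
  let ?S = "sinh_div (csqrt \<alpha>)" and ?C = "cosh_mult (csqrt \<alpha>)"
  define f1 where "f1 = (\<lambda>y. of_real (y powr (1/2)) * ?C (ln y) * \<phi> y)"
  define f2 where "f2 = (\<lambda>y. of_real (y powr (1/2)) * ?S (ln y) * \<phi> y)"
  define k where "k = (\<lambda>y. of_real (x powr (-3/2)) * (?S (ln x) * f1 y - ?C (ln x) * f2 y))"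
  have f: "continuous_on {a..x} f1" "continuous_on {a..x} f2"
    unfolding f1_def f2_def using a by (auto intro!: continuous_intros continuous_on_subset[OF \<phi>])
  then have k: "continuous_on {a..x} k" unfolding k_def by (intro continuous_intros)
  have "Q_op \<alpha> \<phi> x = (\<integral>y. (if y \<in> {a..x} then k y else 0) \<partial>pos_lebesgue)"
    unfolding Q_op_def
  proof (rule Bochner_Integration.integral_cong[OF refl])
    fix y assume "y \<in> space pos_lebesgue"
    then have "y > 0" by (simp add: space_restrict_space)
    then show "Q_kernel \<alpha> x y * \<phi> y = (if y \<in> {a..x} then k y else 0)"
      using supp[of y] x
      by (auto simp: Q_kernel_eq k_def f1_def f2_def sinh_div_diff algebra_simps)
  qed
  also have "\<dots> = integral {a..x} k" by (rule integral_pos_lebesgue_compact[OF k a])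
  also have "\<dots> = of_real (x powr (-3/2)) * (?S (ln x) * integral {a..x} f1 - ?C (ln x) * integral {a..x} f2)"
    unfolding k_def using f[THEN integrable_continuous_interval]
    by (subst integral_mult_right, subst Henstock_Kurzweil_Integration.integral_diff)
      (auto intro!: integrable_on_mult_right)
  finally show ?thesis unfolding f1_def f2_def .
qed

lemma integral_compact_support_const:
  fixes f :: "real \<Rightarrow> 'a::banach"
  assumes "\<And>y. y > b \<Longrightarrow> f y = 0" "b \<le> x"
  shows "integral {a..x} f = integral {a..b} f"
proof -
  have "integral {a..x} f = integral {a..x} (\<lambda>y. if y \<in> {a..b} then f y else 0)"
    using assms by (intro Henstock_Kurzweil_Integration.integral_cong) auto
  also have "\<dots> = integral ({a..b} \<inter> {a..x}) f"
    by (rule Henstock_Kurzweil_Integration.integral_restrict_Int)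
  also have "{a..b} \<inter> {a..x} = {a..b}" using assms(2) by auto
  finally show ?thesis .
qed

text \<open>Both numerators are \<open>O(x powr \<rho>)\<close> with \<open>\<rho> < 1\<close>, so
  the division by \<open>x\<close> wins. Beyond the support of the source, \<open>w\<close> and
  \<open>w'\<close> are combinations of these quotients with constant coefficients.\<close>

lemma sinh_cosh_ln_decay:
  assumes "\<bar>Re m\<bar> < 1"
  shows "((\<lambda>x. sinh_div m (ln x) / of_real x) \<longlongrightarrow> 0) at_top" "((\<lambda>x. cosh_mult m (ln x) / of_real x) \<longlongrightarrow> 0) at_top"
proof -
  obtain c \<rho> where c: "c > 0" "0 < \<rho>" "\<rho> < 1"
    and bound: "\<And>u. u \<ge> 0 \<Longrightarrow> norm (sinh_div m u) \<le> c * exp (\<rho> * u)" "\<And>u. u \<ge> 0 \<Longrightarrow> norm (cosh_mult m u) \<le> c * exp (\<rho> * u)"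
    using sinh_cosh_growth[OF assms] by metis
  have lim: "((\<lambda>x::real. c * x powr (\<rho> - 1)) \<longlongrightarrow> 0) at_top"
    using c by (intro tendsto_mult_right_zero tendsto_neg_powr filterlim_ident) auto
  have *: "((\<lambda>x. f (ln x) / of_real x) \<longlongrightarrow> 0) at_top" if f: "\<And>u. u \<ge> 0 \<Longrightarrow> norm (f u) \<le> c * exp (\<rho> * u)"
    for f :: "real \<Rightarrow> complex"
  proof (rule Lim_null_comparison[OF _ lim])
    show "\<forall>\<^sub>F x in at_top. norm (f (ln x) / of_real x) \<le> c * x powr (\<rho> - 1)"
      using eventually_ge_at_top[of 1]
    proof eventually_elim
      case (elim x)
      then have "norm (f (ln x)) \<le> c * exp (\<rho> * ln x)" by (intro f) auto
      then have "norm (f (ln x)) / x \<le> c * exp (\<rho> * ln x) / x" using elim by (intro divide_right_mono) auto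
      moreover have "x powr (\<rho> - 1) = exp (\<rho> * ln x) / x" using elim by (simp add: powr_diff) (simp add: powr_def)
      ultimately show ?case using elim by (simp add: norm_divide)
    qed
  qed
  show "((\<lambda>x. sinh_div m (ln x) / of_real x) \<longlongrightarrow> 0) at_top" "((\<lambda>x. cosh_mult m (ln x) / of_real x) \<longlongrightarrow> 0) at_top"
    using *[OF bound(1)] *[OF bound(2)] by simp_all
qed

text \<open>The energy identity is integrated against \<open>dx / x\<close>, which is
  \<open>ds\<close>, over \<open>{a..r}\<close>. The boundary form \<open>B\<close> vanishes at
  \<open>a\<close> and tends to 0 at infinity, which leaves \<open>d\<^sup>2\<close> times the
  squared norm of \<open>Q_op \<alpha> \<phi>\<close> below the squared norm of
  \<open>\<phi>\<close>.\<close>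

lemma Q_op_compact_support_estimate:
  assumes \<phi>: "continuous_on UNIV \<phi>" and a: "0 < a" "a < b" and supp: "\<And>y. y \<notin> {a..b} \<Longrightarrow> \<phi> y = 0"
    and \<alpha>: "\<bar>Re (csqrt \<alpha>)\<bar> < 1" and \<beta>: "\<alpha> = 1 - Complex b1 b2"
    and \<gamma>: "\<gamma>\<^sup>2 = 4 - 2 * b1 + 2 * \<omega>\<^sup>2" and b2: "b2 = \<omega> * (b1 - \<omega>\<^sup>2) - 2 * \<omega>"
    and d: "d\<^sup>2 = (b1 - \<omega>\<^sup>2)\<^sup>2 + (b2 + 2 * \<omega>)\<^sup>2" "d > 0"
  shows "Q_op \<alpha> \<phi> \<in> L2_pos" "L2_norm (Q_op \<alpha> \<phi>) \<le> L2_norm \<phi> / d"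
proof -
  define m where "m = csqrt \<alpha>"
  have m2: "m\<^sup>2 = \<alpha>" by (simp add: m_def)
  let ?S = "sinh_div m" and ?C = "cosh_mult m"
  define f1 where "f1 = (\<lambda>y. of_real (y powr (1/2)) * ?C (ln y) * \<phi> y)"
  define f2 where "f2 = (\<lambda>y. of_real (y powr (1/2)) * ?S (ln y) * \<phi> y)"
  define A where "A = (\<lambda>x. integral {a..x} f1)"
  define E where "E = (\<lambda>x. integral {a..x} f2)"
  \<comment> \<open>\<open>W x\<close>, \<open>V x\<close>, \<open>U x\<close> are \<open>w\<close>, \<open>w'\<close>, \<open>w''\<close> at \<open>s = ln x\<close>, so that \<open>x W' = V\<close> and \<open>x V' = U\<close>.\<close>
  define W where "W = (\<lambda>x. (?S (ln x) * A x - ?C (ln x) * E x) / of_real x)"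
  define V where "V = (\<lambda>x. (?C (ln x) * A x - m\<^sup>2 * ?S (ln x) * E x) / of_real x - W x)"
  define U where "U = (\<lambda>x. of_real (x powr (1/2)) * \<phi> x - 2 * V x - Complex b1 b2 * W x)"
  define B where "B = (\<lambda>x. (2 - \<gamma>) * (V x \<bullet> V x) + 2 * (b1 - \<omega>\<^sup>2) * (V x \<bullet> W x)
     + 2 * (b2 + \<gamma> * \<omega>) * ((- \<i> * V x) \<bullet> W x) + (2 * b1 - \<gamma> * \<omega>\<^sup>2) * (W x \<bullet> W x))"
  have h_eq: "Q_op \<alpha> \<phi> x = of_real (x powr (-1/2)) * W x" if "x > 0" for x
  proof -
    have "x powr (-3/2) = x powr (-1/2) / x" using that by (simp add: powr_diff[of x "-1/2" 1, simplified])
    then show ?thesis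
      using Q_op_compact_support_eq[OF \<phi> a(1) _ that, of \<alpha>] supp
      unfolding W_def A_def E_def f1_def f2_def m_def by simp
  qed
  have h_norm: "(cmod (Q_op \<alpha> \<phi> x))\<^sup>2 = (cmod (W x))\<^sup>2 / x" if "x > 0" for x
  proof -
    have "(x powr (-1/2))\<^sup>2 = 1 / x" using that by (simp add: powr_minus_divide powr_half_sqrt power_divide)
    then show ?thesis using that by (simp add: h_eq norm_mult power_mult_distrib del: minus_divide_left)
  qed
  have W0: "W x = 0" if "x \<le> a" for x
    using that by (cases "x = a") (simp_all add: W_def A_def E_def)
  have f: "continuous_on {a..r} f1" "continuous_on {a..r} f2" for r
    unfolding f1_def f2_def using a by (auto intro!: continuous_intros continuous_on_subset[OF \<phi>])
  have deriv: "(W has_vector_derivative V x / of_real x) (at x within {a..r})"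
    "(V has_vector_derivative U x / of_real x) (at x within {a..r})" if x: "x \<in> {a..r}" for x r
  proof -
    have x0: "x > 0" using x a by auto
    have D: "((\<lambda>x. ?S (ln x)) has_vector_derivative ?C (ln x) / of_real x) (at x within {a..r})"
      "((\<lambda>x. ?C (ln x)) has_vector_derivative m\<^sup>2 * ?S (ln x) / of_real x) (at x within {a..r})"
      "(A has_vector_derivative f1 x) (at x within {a..r})" "(E has_vector_derivative f2 x) (at x within {a..r})"
      unfolding A_def E_def using x x0
      by (auto intro!: has_vector_derivative_compose_ln integral_has_vector_derivative f
          sinh_div_has_vector_derivative cosh_mult_has_vector_derivative)
    have inv: "((\<lambda>x. inverse (complex_of_real x)) has_vector_derivative - inverse (of_real x * of_real x)) (at x within {a..r})"
      using x0 by (auto intro!: derivative_eq_intros simp: has_vector_derivative_def scaleR_conv_of_real mult_ac)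
    show W: "(W has_vector_derivative V x / of_real x) (at x within {a..r})"
      unfolding W_def divide_inverse
      by (rule has_vector_derivative_eq_rhs, (rule has_vector_derivative_mult has_vector_derivative_diff D inv)+)
        (use x0 in \<open>simp add: V_def W_def f1_def f2_def field_simps\<close>)
    have DS: "((\<lambda>x. m\<^sup>2 * ?S (ln x)) has_vector_derivative m\<^sup>2 * (?C (ln x) / of_real x)) (at x within {a..r})"
      by (rule has_vector_derivative_mult_right[OF D(1)])
    have T: "(?C (ln x) * A x - m\<^sup>2 * ?S (ln x) * E x) / of_real x = V x + W x"
      by (simp add: V_def)
    have mW: "(m\<^sup>2 * ?S (ln x) * A x - m\<^sup>2 * ?C (ln x) * E x) / of_real x = m\<^sup>2 * W x"
      by (simp add: W_def algebra_simps)
    \<comment> \<open>The derivatives of \<open>A\<close> and \<open>E\<close> combine through the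
      Wronskian into the source term alone.\<close>
    have "?C (ln x) * f1 x - m\<^sup>2 * ?S (ln x) * f2 x = of_real (x powr (1/2)) * \<phi> x * ((?C (ln x))\<^sup>2 - m\<^sup>2 * (?S (ln x))\<^sup>2)"
      by (simp add: f1_def f2_def power2_eq_square algebra_simps)
    then have key: "?C (ln x) * f1 x - m\<^sup>2 * ?S (ln x) * f2 x = of_real (x powr (1/2)) * \<phi> x"
      by (simp add: cosh_sinh_div_identity)
    have "(V has_vector_derivative
       (?C (ln x) * A x - m\<^sup>2 * ?S (ln x) * E x) * - inverse (of_real x * of_real x)
       + ((?C (ln x) * f1 x + m\<^sup>2 * ?S (ln x) / of_real x * A x)
          - (m\<^sup>2 * ?S (ln x) * f2 x + m\<^sup>2 * (?C (ln x) / of_real x) * E x)) * inverse (of_real x)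
       - V x / of_real x) (at x within {a..r})"
      unfolding V_def[abs_def] divide_inverse[of "_ - _"]
      by (rule has_vector_derivative_mult has_vector_derivative_diff D DS inv W[unfolded V_def divide_inverse])+
    moreover have "(?C (ln x) * A x - m\<^sup>2 * ?S (ln x) * E x) * - inverse (of_real x * of_real x)
       + ((?C (ln x) * f1 x + m\<^sup>2 * ?S (ln x) / of_real x * A x)
          - (m\<^sup>2 * ?S (ln x) * f2 x + m\<^sup>2 * (?C (ln x) / of_real x) * E x)) * inverse (of_real x)
       - V x / of_real x
      = (- ((?C (ln x) * A x - m\<^sup>2 * ?S (ln x) * E x) / of_real x)
        + (?C (ln x) * f1 x - m\<^sup>2 * ?S (ln x) * f2 x)
        + (m\<^sup>2 * ?S (ln x) * A x - m\<^sup>2 * ?C (ln x) * E x) / of_real x - V x) / of_real x"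
      using x0 by (simp add: field_simps)
    moreover have \<beta>': "Complex b1 b2 = 1 - m\<^sup>2" using \<beta> m2 by simp
    \<comment> \<open>This is the differential equation: the derivative just computed agrees with
      \<open>U\<close>, which was defined by solving the equation for \<open>w''\<close>.\<close>
    have "- (V x + W x) + of_real (x powr (1/2)) * \<phi> x + m\<^sup>2 * W x - V x = U x"
      unfolding U_def \<beta>' by (simp add: algebra_simps)
    ultimately show "(V has_vector_derivative U x / of_real x) (at x within {a..r})"
      unfolding T mW key by simp
  qed
  have contWV: "continuous_on {a..r} W" "continuous_on {a..r} V" for r
    using continuous_on_vector_derivative[OF deriv(1)] continuous_on_vector_derivative[OF deriv(2)] by blast+
  have B_ge: "d\<^sup>2 * integral {a..r} (\<lambda>x. (cmod (W x))\<^sup>2 / x) \<le> integral {a..r} (\<lambda>x. (cmod (\<phi> x))\<^sup>2) - B r"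
    if r: "a \<le> r" for r
  proof -
    define D where "D = (\<lambda>x. ((2 - \<gamma>) * (2 * (U x \<bullet> V x)) + 2 * (b1 - \<omega>\<^sup>2) * (U x \<bullet> W x + V x \<bullet> V x)
       + 2 * (b2 + \<gamma> * \<omega>) * ((- \<i> * U x) \<bullet> W x) + (2 * b1 - \<gamma> * \<omega>\<^sup>2) * (2 * (V x \<bullet> W x))) / x)"
    have "(D has_integral B r - B a) {a..r}"
    proof (rule fundamental_theorem_of_calculus[OF r])
      fix x assume x: "x \<in> {a..r}"
      then have x0: "x > 0" using a by auto
      note inner = bounded_bilinear.has_vector_derivative[OF bounded_bilinear_inner]
      have "(B has_vector_derivative
        (2 - \<gamma>) * (V x \<bullet> (U x / of_real x) + (U x / of_real x) \<bullet> V x)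
        + 2 * (b1 - \<omega>\<^sup>2) * (V x \<bullet> (V x / of_real x) + (U x / of_real x) \<bullet> W x)
        + 2 * (b2 + \<gamma> * \<omega>) * ((- \<i> * V x) \<bullet> (V x / of_real x) + (- \<i> * (U x / of_real x)) \<bullet> W x)
        + (2 * b1 - \<gamma> * \<omega>\<^sup>2) * (W x \<bullet> (V x / of_real x) + (V x / of_real x) \<bullet> W x)) (at x within {a..r})"
        unfolding B_def
        by (intro has_vector_derivative_add has_vector_derivative_mult_right inner deriv x)
      also have "(2 - \<gamma>) * (V x \<bullet> (U x / of_real x) + (U x / of_real x) \<bullet> V x)
        + 2 * (b1 - \<omega>\<^sup>2) * (V x \<bullet> (V x / of_real x) + (U x / of_real x) \<bullet> W x)
        + 2 * (b2 + \<gamma> * \<omega>) * ((- \<i> * V x) \<bullet> (V x / of_real x) + (- \<i> * (U x / of_real x)) \<bullet> W x)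
        + (2 * b1 - \<gamma> * \<omega>\<^sup>2) * (W x \<bullet> (V x / of_real x) + (V x / of_real x) \<bullet> W x) = D x"
      proof -
        have div: "z / of_real x = (1 / x) *\<^sub>R z" for z :: complex
          by (simp add: scaleR_conv_of_real)
        \<comment> \<open>A complex number is orthogonal to its product with \<open>\<i>\<close>, so
          the third term of \<open>B\<close> contributes no square of \<open>V x\<close>.\<close>
        have orth: "(- \<i> * V x) \<bullet> V x = 0" by (simp add: inner_complex_def)
        have "W x \<bullet> V x = V x \<bullet> W x" "V x \<bullet> U x = U x \<bullet> V x" by (simp_all add: inner_commute)
        moreover have "k1 * (t * p + t * p) + k2 * (t * q + t * r) + k3 * (t * 0 + t * s) + k4 * (t * u + t * u)
            = (k1 * (2 * p) + k2 * (r + q) + k3 * s + k4 * (2 * u)) * t" for k1 k2 k3 k4 t p q r s u :: real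
          by algebra
        ultimately show ?thesis
          unfolding D_def div mult_scaleR_right inner_scaleR_left inner_scaleR_right orth
          by (simp only: divide_inverse mult_1_left)
      qed
      finally show "(B has_vector_derivative D x) (at x within {a..r})" .
    qed
    moreover have "B a = 0"
    proof -
      have "V a = 0" by (simp add: V_def A_def E_def W0)
      then show ?thesis by (simp add: B_def W0)
    qed
    ultimately have D_int: "(D has_integral B r) {a..r}" by simp
    have c1: "continuous_on {a..r} (\<lambda>x. (cmod (\<phi> x))\<^sup>2)"
      by (intro continuous_intros continuous_on_subset[OF \<phi>]) auto
    have c2: "continuous_on {a..r} (\<lambda>x. (cmod (W x))\<^sup>2 / x)"
      using a by (intro continuous_intros contWV) auto
    have "((\<lambda>x. (cmod (\<phi> x))\<^sup>2 - d\<^sup>2 * ((cmod (W x))\<^sup>2 / x)) has_integral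
       (integral {a..r} (\<lambda>x. (cmod (\<phi> x))\<^sup>2) - d\<^sup>2 * integral {a..r} (\<lambda>x. (cmod (W x))\<^sup>2 / x))) {a..r}"
      using c1[THEN integrable_continuous_interval] c2[THEN integrable_continuous_interval]
      by (intro has_integral_diff has_integral_mult_right integrable_integral)
    then have "B r \<le> integral {a..r} (\<lambda>x. (cmod (\<phi> x))\<^sup>2) - d\<^sup>2 * integral {a..r} (\<lambda>x. (cmod (W x))\<^sup>2 / x)"
    proof (rule has_integral_le[OF D_int])
      fix x assume x: "x \<in> {a..r}"
      then have x0: "x > 0" using a by auto
      have "U x + 2 * V x + Complex b1 b2 * W x = of_real (x powr (1/2)) * \<phi> x"
        by (simp add: U_def)
      moreover have "(x powr (1/2))\<^sup>2 = x" using x0 by (simp add: powr_power)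
      ultimately have "D x = (x * (cmod (\<phi> x))\<^sup>2 - d\<^sup>2 * (cmod (W x))\<^sup>2
         - (cmod (U x + of_real \<gamma> * V x + Complex (\<omega>\<^sup>2) (- \<gamma> * \<omega>) * W x))\<^sup>2) / x"
        unfolding D_def energy_identity[OF \<gamma> b2 d(1)] by (simp add: norm_mult power_mult_distrib)
      \<comment> \<open>The square of \<open>q(\<partial>) w\<close> enters with a negative sign and
        is dropped.\<close>
      also have "\<dots> \<le> (x * (cmod (\<phi> x))\<^sup>2 - d\<^sup>2 * (cmod (W x))\<^sup>2) / x"
        using x0 by (intro divide_right_mono) auto
      also have "\<dots> = (cmod (\<phi> x))\<^sup>2 - d\<^sup>2 * ((cmod (W x))\<^sup>2 / x)"
        using x0 by (simp add: field_simps)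
      finally show "D x \<le> (cmod (\<phi> x))\<^sup>2 - d\<^sup>2 * ((cmod (W x))\<^sup>2 / x)" .
    qed
    then show ?thesis by simp
  qed
  have \<phi>_L2: "integral {a..r} (\<lambda>x. (cmod (\<phi> x))\<^sup>2) = (L2_norm \<phi>)\<^sup>2" if "b \<le> r" for r
  proof -
    have "integral {a..r} (\<lambda>x. (cmod (\<phi> x))\<^sup>2) = (\<integral>x. (if x \<in> {a..r} then (cmod (\<phi> x))\<^sup>2 else 0) \<partial>pos_lebesgue)"
      by (intro integral_pos_lebesgue_compact[symmetric] a continuous_intros continuous_on_subset[OF \<phi>]) auto
    also have "(\<lambda>x. if x \<in> {a..r} then (cmod (\<phi> x))\<^sup>2 else 0) = (\<lambda>x. (cmod (\<phi> x))\<^sup>2)"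
    proof
      show "(if x \<in> {a..r} then (cmod (\<phi> x))\<^sup>2 else 0) = (cmod (\<phi> x))\<^sup>2" for x
        using supp[of x] that by (cases "x \<in> {a..b}") auto
    qed
    finally show ?thesis by (simp add: L2_norm_power2)
  qed
  have "(W \<longlongrightarrow> 0) at_top" "(V \<longlongrightarrow> 0) at_top"
  proof -
    \<comment> \<open>Past the support of \<open>\<phi>\<close> both integrals are constant.\<close>
    have A: "(A \<longlongrightarrow> A b) at_top" "(E \<longlongrightarrow> E b) at_top"
      unfolding A_def E_def
      by (intro tendsto_eventually eventually_at_top_linorderI[of b] integral_compact_support_const;
          simp add: f1_def f2_def supp)+
    note lim = sinh_cosh_ln_decay[of m]
    have \<alpha>': "\<bar>Re m\<bar> < 1" using \<alpha> by (simp add: m_def)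
    have "((\<lambda>x. ?S (ln x) / of_real x * A x - ?C (ln x) / of_real x * E x) \<longlongrightarrow> 0 * A b - 0 * E b) at_top"
      by (intro tendsto_intros A lim \<alpha>')
    then show W: "(W \<longlongrightarrow> 0) at_top" by (simp add: W_def[abs_def] diff_divide_distrib)
    have "((\<lambda>x. ?C (ln x) / of_real x * A x - m\<^sup>2 * (?S (ln x) / of_real x) * E x - W x) \<longlongrightarrow> 0 * A b - m\<^sup>2 * 0 * E b - 0) at_top"
      by (intro tendsto_intros A lim \<alpha>' W)
    then show "(V \<longlongrightarrow> 0) at_top" by (simp add: V_def[abs_def] diff_divide_distrib)
  qed
  then have "(B \<longlongrightarrow> (2 - \<gamma>) * (0 \<bullet> (0::complex)) + 2 * (b1 - \<omega>\<^sup>2) * (0 \<bullet> (0::complex))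
     + 2 * (b2 + \<gamma> * \<omega>) * ((- \<i> * 0) \<bullet> 0) + (2 * b1 - \<gamma> * \<omega>\<^sup>2) * (0 \<bullet> (0::complex))) at_top"
    unfolding B_def by (intro tendsto_intros)
  then have B_lim: "(B \<longlongrightarrow> 0) at_top" by simp
  \<comment> \<open>Truncations to intervals exhausting \<open>{a..}\<close>. Below \<open>a\<close>
    the function \<open>Q_op \<alpha> \<phi>\<close> vanishes, so they converge pointwise on the
    whole half-line. Each right end is at least \<open>b\<close>, so the squared modulus of
    \<open>\<phi>\<close> integrates to the full squared norm.\<close>
  define H where "H = (\<lambda>n x. if x \<in> {a..b + real n} then Q_op \<alpha> \<phi> x else 0)"
  have conth: "continuous_on {a..r} (Q_op \<alpha> \<phi>)" for r
  proof (rule continuous_on_eq)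
    show "continuous_on {a..r} (\<lambda>x. of_real (x powr (-1/2)) * W x)"
      using a by (intro continuous_intros contWV) auto
  qed (use a h_eq in auto)
  have H_lim: "(\<lambda>n. H n x) \<longlonglongrightarrow> Q_op \<alpha> \<phi> x" if "x \<in> space pos_lebesgue" for x
  proof (rule tendsto_eventually)
    have x: "x > 0" using that by (simp add: space_restrict_space)
    obtain N where N: "x \<le> real N" using real_arch_simple by blast
    show "\<forall>\<^sub>F n in sequentially. H n x = Q_op \<alpha> \<phi> x"
      using eventually_ge_at_top[of N]
    proof eventually_elim
      case (elim n)
      then have "x \<le> b + real n" using N a by simp
      then show ?case using h_eq[OF x] W0[of x] by (auto simp: H_def)
    qed
  qed
  have H_sq: "(\<lambda>x. (cmod (H n x))\<^sup>2) = (\<lambda>x. if x \<in> {a..b + real n} then (cmod (Q_op \<alpha> \<phi> x))\<^sup>2 else 0)" for n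
    by (auto simp: H_def)
  have H_int: "integrable pos_lebesgue (\<lambda>x. (cmod (H n x))\<^sup>2)" for n
    unfolding H_sq by (intro integrable_pos_lebesgue_compact continuous_intros conth a)
  have H_le: "(\<integral>x. (cmod (H n x))\<^sup>2 \<partial>pos_lebesgue) \<le> ((L2_norm \<phi>)\<^sup>2 - B (b + real n)) / d\<^sup>2" for n
  proof -
    have "(\<integral>x. (cmod (H n x))\<^sup>2 \<partial>pos_lebesgue) = integral {a..b + real n} (\<lambda>x. (cmod (Q_op \<alpha> \<phi> x))\<^sup>2)"
      unfolding H_sq by (intro integral_pos_lebesgue_compact continuous_intros conth a)
    also have "\<dots> = integral {a..b + real n} (\<lambda>x. (cmod (W x))\<^sup>2 / x)"
      using a by (intro Henstock_Kurzweil_Integration.integral_cong h_norm) auto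
    finally show ?thesis
      using B_ge[of "b + real n"] \<phi>_L2[of "b + real n"] a d(2) by (simp add: field_simps)
  qed
  have "filterlim (\<lambda>n. b + real n) at_top sequentially"
    by (rule filterlim_tendsto_add_at_top[OF tendsto_const filterlim_real_sequentially])
  from filterlim_compose[OF B_lim this]
  have "(\<lambda>n. ((L2_norm \<phi>)\<^sup>2 - B (b + real n)) / d\<^sup>2) \<longlonglongrightarrow> ((L2_norm \<phi>)\<^sup>2 - 0) / d\<^sup>2"
    using d(2) by (intro tendsto_intros) auto
  note Fatou = Fatou_integrable[OF H_int _ tendsto_power[OF tendsto_norm[OF H_lim]] H_le this]
  have "(\<lambda>x. Q_op \<alpha> \<phi> x) \<in> borel_measurable pos_lebesgue"
  proof (rule borel_measurable_LIMSEQ_metric[OF _ H_lim])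
    show "H n \<in> borel_measurable pos_lebesgue" for n
      unfolding H_def by (rule borel_measurable_integrable[OF integrable_pos_lebesgue_compact[OF conth a(1)]])
  qed
  then show "Q_op \<alpha> \<phi> \<in> L2_pos" using Fatou(1) by (intro L2_posI) auto
  have "(L2_norm (Q_op \<alpha> \<phi>))\<^sup>2 \<le> (L2_norm \<phi> / d)\<^sup>2"
    using Fatou(2) by (simp add: L2_norm_power2 power_divide)
  then show "L2_norm (Q_op \<alpha> \<phi>) \<le> L2_norm \<phi> / d"
    by (rule power2_le_imp_le) (use d(2) in \<open>simp add: L2_norm_nonneg\<close>)
qed

section \<open>Extension of the estimate to all square-integrable functions\<close>

lemma Q_op_integrable:
  assumes "\<bar>Re (csqrt \<alpha>)\<bar> < 1" "g \<in> L2_pos" "x > 0"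
  shows "integrable pos_lebesgue (\<lambda>y. Q_kernel \<alpha> x y * g y)"
  by (rule L2_pos_integrable_mult[OF Q_kernel_L2_pos[OF assms(1,3)] assms(2)])

text \<open>For fixed \<open>x\<close> the slice \<open>Q_kernel \<alpha> x\<close> is square
  integrable, so approximation of \<open>g\<close> in norm makes
  \<open>Q_op \<alpha> (\<phi> n) x\<close> converge at every \<open>x > 0\<close>. Fatou's lemma
  carries the norm bound to the limit, and measurability follows from pointwise convergence.\<close>

lemma Q_op_estimate:
  assumes g: "g \<in> L2_pos"
    and \<alpha>: "\<bar>Re (csqrt \<alpha>)\<bar> < 1" and \<beta>: "\<alpha> = 1 - Complex b1 b2"
    and \<gamma>: "\<gamma>\<^sup>2 = 4 - 2 * b1 + 2 * \<omega>\<^sup>2" and b2: "b2 = \<omega> * (b1 - \<omega>\<^sup>2) - 2 * \<omega>"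
    and d: "d\<^sup>2 = (b1 - \<omega>\<^sup>2)\<^sup>2 + (b2 + 2 * \<omega>)\<^sup>2" "d > 0"
  shows "Q_op \<alpha> g \<in> L2_pos" "L2_norm (Q_op \<alpha> g) \<le> L2_norm g / d"
proof -
  have "\<exists>\<phi>. \<phi> \<in> L2_pos \<and> L2_norm (\<lambda>y. g y - \<phi> y) < e \<and> Q_op \<alpha> \<phi> \<in> L2_pos \<and> L2_norm (Q_op \<alpha> \<phi>) \<le> L2_norm \<phi> / d"
    if e: "e > 0" for e
  proof -
    obtain \<phi> a b where "continuous_on UNIV \<phi>" "0 < a" "a < b" "\<And>y. y \<notin> {a..b} \<Longrightarrow> \<phi> y = 0"
      "L2_norm (\<lambda>y. g y - \<phi> y) < e" "\<phi> \<in> L2_pos"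
      using L2_pos_approx_continuous[OF g e] by blast
    then show ?thesis
      using Q_op_compact_support_estimate[OF _ _ _ _ \<alpha> \<beta> \<gamma> b2 d] by blast
  qed
  then have "\<forall>n. \<exists>\<phi>. \<phi> \<in> L2_pos \<and> L2_norm (\<lambda>y. g y - \<phi> y) < inverse (real (Suc n)) \<and> Q_op \<alpha> \<phi> \<in> L2_pos
      \<and> L2_norm (Q_op \<alpha> \<phi>) \<le> L2_norm \<phi> / d"
    by simp
  from choice[OF this] obtain \<phi> where \<phi>: "\<And>n. \<phi> n \<in> L2_pos"
    and close: "\<And>n. L2_norm (\<lambda>y. g y - \<phi> n y) < inverse (real (Suc n))"
    and Q\<phi>: "\<And>n. Q_op \<alpha> (\<phi> n) \<in> L2_pos" "\<And>n. L2_norm (Q_op \<alpha> (\<phi> n)) \<le> L2_norm (\<phi> n) / d"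
    by blast
  have lim: "(\<lambda>n. Q_op \<alpha> (\<phi> n) x) \<longlonglongrightarrow> Q_op \<alpha> g x" if "x \<in> space pos_lebesgue" for x
  proof -
    have x: "x > 0" using that by (simp add: space_restrict_space)
    have "(\<lambda>n. Q_op \<alpha> (\<phi> n) x - Q_op \<alpha> g x) \<longlonglongrightarrow> 0"
    proof (rule Lim_null_comparison)
      show "\<forall>\<^sub>F n in sequentially. norm (Q_op \<alpha> (\<phi> n) x - Q_op \<alpha> g x) \<le> L2_norm (Q_kernel \<alpha> x) * inverse (real (Suc n))"
      proof (rule always_eventually, rule allI)
        fix n
        have "Q_op \<alpha> g x - Q_op \<alpha> (\<phi> n) x = (\<integral>y. Q_kernel \<alpha> x y * (g y - \<phi> n y) \<partial>pos_lebesgue)"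
          unfolding Q_op_def right_diff_distrib
          by (rule Bochner_Integration.integral_diff[symmetric]) (intro Q_op_integrable \<alpha> g \<phi> x)+
        then have "norm (Q_op \<alpha> (\<phi> n) x - Q_op \<alpha> g x) \<le> L2_norm (Q_kernel \<alpha> x) * L2_norm (\<lambda>y. g y - \<phi> n y)"
          using L2_pos_integral_mult_le[OF Q_kernel_L2_pos[OF \<alpha> x] L2_pos_diff[OF g \<phi>[of n]]]
          by (simp add: norm_minus_commute)
        also have "\<dots> \<le> L2_norm (Q_kernel \<alpha> x) * inverse (real (Suc n))"
          using close[of n] by (intro mult_left_mono L2_norm_nonneg) simp
        finally show "norm (Q_op \<alpha> (\<phi> n) x - Q_op \<alpha> g x) \<le> L2_norm (Q_kernel \<alpha> x) * inverse (real (Suc n))" .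
      qed
      show "(\<lambda>n. L2_norm (Q_kernel \<alpha> x) * inverse (real (Suc n))) \<longlonglongrightarrow> 0"
        by (rule tendsto_mult_right_zero[OF LIMSEQ_inverse_real_of_nat])
    qed
    then show ?thesis by (rule Lim_null[THEN iffD2])
  qed
  have c_lim: "(\<lambda>n. ((L2_norm g + inverse (real (Suc n))) / d)\<^sup>2) \<longlonglongrightarrow> ((L2_norm g + 0) / d)\<^sup>2"
    using d(2) by (intro tendsto_intros LIMSEQ_inverse_real_of_nat) auto
  have c_ge: "(\<integral>x. (cmod (Q_op \<alpha> (\<phi> n) x))\<^sup>2 \<partial>pos_lebesgue) \<le> ((L2_norm g + inverse (real (Suc n))) / d)\<^sup>2" for n
  proof -
    \<comment> \<open>Writing \<open>\<phi> n\<close> as \<open>g - (g - \<phi> n)\<close> bounds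
      its norm by that of \<open>g\<close> plus the approximation error.\<close>
    have "L2_norm (\<lambda>y. g y + (-1) * (g y - \<phi> n y)) \<le> L2_norm g + L2_norm (\<lambda>y. (-1) * (g y - \<phi> n y))"
      by (intro L2_pos_add g L2_pos_cmult L2_pos_diff \<phi>)
    also have "L2_norm (\<lambda>y. (-1) * (g y - \<phi> n y)) = L2_norm (\<lambda>y. g y - \<phi> n y)"
      by (subst L2_pos_cmult(2)[OF L2_pos_diff[OF g \<phi>]]) simp
    finally have "L2_norm (\<phi> n) \<le> L2_norm g + inverse (real (Suc n))" using close[of n] by simp
    then have "L2_norm (Q_op \<alpha> (\<phi> n)) \<le> (L2_norm g + inverse (real (Suc n))) / d"
      using Q\<phi>(2)[of n] d(2) by (meson divide_right_mono less_imp_le order_trans)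
    then show ?thesis unfolding L2_norm_power2[symmetric] by (rule power_mono[OF _ L2_norm_nonneg])
  qed
  note Fatou = Fatou_integrable[OF L2_posD(2)[OF Q\<phi>(1)] _ tendsto_power[OF tendsto_norm[OF lim]] c_ge c_lim]
  have "(\<lambda>x. Q_op \<alpha> g x) \<in> borel_measurable pos_lebesgue"
    by (rule borel_measurable_LIMSEQ_metric[OF L2_posD(1)[OF Q\<phi>(1)] lim])
  then show "Q_op \<alpha> g \<in> L2_pos" using Fatou(1) by (intro L2_posI) auto
  have "(L2_norm (Q_op \<alpha> g))\<^sup>2 \<le> (L2_norm g / d)\<^sup>2"
    using Fatou(2) by (simp add: L2_norm_power2)
  then show "L2_norm (Q_op \<alpha> g) \<le> L2_norm g / d"
    by (rule power2_le_imp_le) (use d(2) in \<open>simp add: L2_norm_nonneg\<close>)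
qed

section \<open>The nearest point of the parabola and the conditions that hold there\<close>

lemma parabola_nearest_point:
  obtains \<omega> where "infdist \<alpha> {(1 + \<i> * complex_of_real \<omega>)\<^sup>2 | \<omega>. True} = cmod ((1 + \<i> * complex_of_real \<omega>)\<^sup>2 - \<alpha>)"
    "\<And>\<omega>'. cmod ((1 + \<i> * complex_of_real \<omega>)\<^sup>2 - \<alpha>) \<le> cmod ((1 + \<i> * complex_of_real \<omega>')\<^sup>2 - \<alpha>)"
proof -
  define f where "f = (\<lambda>\<omega>. cmod ((1 + \<i> * complex_of_real \<omega>)\<^sup>2 - \<alpha>))"
  \<comment> \<open>For \<open>\<bar>\<omega>'\<bar> \<ge> r\<close> this gives
    \<open>\<omega>'\<^sup>2 \<ge> r \<ge> 2 * cmod \<alpha>\<close>. Since the point of the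
    parabola has modulus \<open>1 + \<omega>'\<^sup>2\<close>, its distance from
    \<open>\<alpha>\<close> is then at least \<open>1 + cmod \<alpha>\<close>, hence at least
    \<open>f 0\<close>, and the minimum over the compact interval is global.\<close>
  define r where "r = 2 * cmod \<alpha> + 1"
  have norm_eq: "cmod ((1 + \<i> * complex_of_real \<omega>)\<^sup>2) = 1 + \<omega>\<^sup>2" for \<omega>
    by (simp add: norm_power cmod_power2)
  have "continuous_on {-r..r} f" unfolding f_def by (intro continuous_intros)
  moreover have r: "r > 0" by (auto simp: r_def intro: add_nonneg_pos)
  then have "{-r..r} \<noteq> {}" by simp
  ultimately obtain \<omega> where \<omega>: "\<omega> \<in> {-r..r}" "\<And>\<omega>'. \<omega>' \<in> {-r..r} \<Longrightarrow> f \<omega> \<le> f \<omega>'"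
    using continuous_attains_inf[of "{-r..r}" f] by auto
  have min: "f \<omega> \<le> f \<omega>'" for \<omega>'
  proof (cases "\<omega>' \<in> {-r..r}")
    case False
    then have "\<bar>\<omega>'\<bar> \<ge> r" by auto
    then have "r * r \<le> \<bar>\<omega>'\<bar> * \<bar>\<omega>'\<bar>" by (intro mult_mono) (auto simp: r_def)
    moreover have "r * 1 \<le> r * r" by (intro mult_left_mono) (auto simp: r_def)
    ultimately have "2 * cmod \<alpha> \<le> \<omega>'\<^sup>2" by (simp add: r_def power2_eq_square)
    moreover have "1 + \<omega>'\<^sup>2 - cmod \<alpha> \<le> f \<omega>'"
      using norm_triangle_ineq2[of "(1 + \<i> * complex_of_real \<omega>')\<^sup>2" \<alpha>] by (simp add: f_def norm_eq)
    moreover have "f 0 \<le> 1 + cmod \<alpha>"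
      using norm_triangle_ineq4[of 1 \<alpha>] by (simp add: f_def)
    moreover have "f \<omega> \<le> f 0" by (rule \<omega>(2)) (use r in simp)
    ultimately show ?thesis by linarith
  qed (rule \<omega>(2))
  let ?P = "{(1 + \<i> * complex_of_real \<omega>)\<^sup>2 | \<omega>. True}"
  have "infdist \<alpha> ?P = f \<omega>"
  proof (rule antisym)
    have "infdist \<alpha> ?P \<le> dist \<alpha> ((1 + \<i> * complex_of_real \<omega>)\<^sup>2)" by (rule infdist_le) auto
    then show "infdist \<alpha> ?P \<le> f \<omega>" by (simp add: f_def dist_norm norm_minus_commute)
    have ne: "?P \<noteq> {}" by auto
    show "f \<omega> \<le> infdist \<alpha> ?P"
      unfolding infdist_notempty[OF ne]
      by (rule cINF_greatest[OF ne]) (use min in \<open>auto simp: f_def dist_norm norm_minus_commute\<close>)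
  qed
  with min that show ?thesis unfolding f_def by blast
qed

text \<open>The derivative vanishes at a minimum, which determines \<open>b2\<close>. The difference
  to the minimum is then divisible by \<open>(\<omega>' - \<omega>)\<^sup>2\<close>, and
  nonnegativity of the remaining factor \<open>c + (\<omega>' + \<omega>)\<^sup>2\<close> off
  \<open>\<omega>\<close> forces \<open>c \<ge> 0\<close>. This \<open>c\<close> becomes
  \<open>\<gamma>\<^sup>2\<close>.\<close>

lemma quartic_minimum_conditions:
  fixes \<omega> b1 b2 :: real
  assumes min: "\<And>\<omega>'. (b1 - \<omega>\<^sup>2)\<^sup>2 + (b2 + 2 * \<omega>)\<^sup>2 \<le> (b1 - \<omega>'\<^sup>2)\<^sup>2 + (b2 + 2 * \<omega>')\<^sup>2"
  shows "b2 = \<omega> * (b1 - \<omega>\<^sup>2) - 2 * \<omega>" "4 - 2 * b1 + 2 * \<omega>\<^sup>2 \<ge> 0"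
proof -
  have "((\<lambda>x. (b1 - x\<^sup>2)\<^sup>2 + (b2 + 2 * x)\<^sup>2) has_real_derivative
      2 * (b1 - \<omega>\<^sup>2) * (- (2 * \<omega>)) + 2 * (b2 + 2 * \<omega>) * 2) (at \<omega>)"
    by (auto intro!: derivative_eq_intros)
  from DERIV_local_min[OF this zero_less_one] min
  have "2 * (b1 - \<omega>\<^sup>2) * (- (2 * \<omega>)) + 2 * (b2 + 2 * \<omega>) * 2 = 0" by blast
  then show b2: "b2 = \<omega> * (b1 - \<omega>\<^sup>2) - 2 * \<omega>" by (simp add: algebra_simps)
  define c where "c = 4 - 2 * b1 + 2 * \<omega>\<^sup>2"
  have c: "c + (\<omega>' + \<omega>)\<^sup>2 \<ge> 0" if "\<omega>' \<noteq> \<omega>" for \<omega>'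
  proof -
    have "0 \<le> (b1 - \<omega>'\<^sup>2)\<^sup>2 + (b2 + 2 * \<omega>')\<^sup>2 - ((b1 - \<omega>\<^sup>2)\<^sup>2 + (b2 + 2 * \<omega>)\<^sup>2)"
      using min[of \<omega>'] by simp
    also have "\<dots> = (\<omega>' - \<omega>)\<^sup>2 * (c + (\<omega>' + \<omega>)\<^sup>2)"
      unfolding b2 c_def by (simp add: power2_eq_square algebra_simps)
    finally show ?thesis using that by (simp add: zero_le_mult_iff)
  qed
  have "c \<ge> 0"
  proof (rule ccontr)
    assume "\<not> c \<ge> 0"
    \<comment> \<open>The obvious test point \<open>- \<omega>\<close> coincides with
      \<open>\<omega>\<close> if \<open>\<omega> = 0\<close>. At \<open>- \<omega> + s\<close> and
      \<open>- \<omega> - s\<close> the factor is \<open>c / 2 < 0\<close>, and at most one of these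
      points equals \<open>\<omega>\<close>.\<close>
    define s where "s = sqrt (- c / 2)"
    have s: "s > 0" "s\<^sup>2 = - c / 2" using \<open>\<not> c \<ge> 0\<close> by (auto simp: s_def)
    show False
    proof (cases "- \<omega> + s = \<omega>")
      case True
      then have "- \<omega> - s \<noteq> \<omega>" using s by simp
      from c[OF this] show False using s \<open>\<not> c \<ge> 0\<close> by simp
    next
      case False
      from c[OF this] show False using s \<open>\<not> c \<ge> 0\<close> by simp
    qed
  qed
  then show "4 - 2 * b1 + 2 * \<omega>\<^sup>2 \<ge> 0" by (simp add: c_def)
qed

text \<open>A point of the parabola has the square root \<open>1 + \<i> * \<omega>\<close> with real
  part 1, which the hypothesis excludes for \<open>\<alpha>\<close>.\<close>

lemma parabola_distance_pos:
  assumes "\<bar>Re (csqrt \<alpha>)\<bar> < 1"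
  shows "cmod ((1 + \<i> * complex_of_real \<omega>)\<^sup>2 - \<alpha>) > 0"
proof -
  have "(1 + \<i> * complex_of_real \<omega>)\<^sup>2 \<noteq> \<alpha>"
    using abs_Re_square_root[of "1 + \<i> * complex_of_real \<omega>" \<alpha>] assms by auto
  then show ?thesis by simp
qed

section \<open>The lower bound\<close>

text \<open>A bounded antiderivative of the squared modulus bounds its integrals over all compact
  intervals by \<open>2 * C\<close>, and Fatou's lemma gives integrability. The increase of
  \<open>F\<close> from 1 to 2 keeps the norm away from 0.\<close>

lemma
  assumes cont: "continuous_on {0<..} g" and le: "\<And>x. x > 0 \<Longrightarrow> (cmod (g x))\<^sup>2 = f x"
    and F: "\<And>x. x > 0 \<Longrightarrow> (F has_vector_derivative f x) (at x)"
    and bound: "\<And>x. x > 0 \<Longrightarrow> \<bar>F x\<bar> \<le> C" and less: "F 1 < F 2"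
  shows L2_posI_antiderivative: "g \<in> L2_pos" and L2_norm_pos_antiderivative: "L2_norm g > 0"
proof -
  have meas: "g \<in> borel_measurable pos_lebesgue"
    by (rule borel_measurable_pos_lebesgue_continuous[OF cont])
  have int: "integrable pos_lebesgue (\<lambda>x. if x \<in> {a..r} then (cmod (g x))\<^sup>2 else 0)"
    and eq: "(\<integral>x. (if x \<in> {a..r} then (cmod (g x))\<^sup>2 else 0) \<partial>pos_lebesgue) = F r - F a" if a: "0 < a" "a \<le> r" for a r
  proof -
    have c: "continuous_on {a..r} (\<lambda>x. (cmod (g x))\<^sup>2)"
      using a by (intro continuous_intros continuous_on_subset[OF cont]) auto
    show "integrable pos_lebesgue (\<lambda>x. if x \<in> {a..r} then (cmod (g x))\<^sup>2 else 0)"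
      by (rule integrable_pos_lebesgue_compact[OF c a(1)])
    have "((\<lambda>x. (cmod (g x))\<^sup>2) has_integral F r - F a) {a..r}"
    proof (rule fundamental_theorem_of_calculus[OF a(2)])
      fix x assume "x \<in> {a..r}"
      then have "x > 0" using a by simp
      then show "(F has_vector_derivative (cmod (g x))\<^sup>2) (at x within {a..r})"
        unfolding le[OF \<open>x > 0\<close>] by (rule has_vector_derivative_at_within[OF F])
    qed
    then show "(\<integral>x. (if x \<in> {a..r} then (cmod (g x))\<^sup>2 else 0) \<partial>pos_lebesgue) = F r - F a"
      by (rule trans[OF integral_pos_lebesgue_compact[OF c a(1)] integral_unique])
  qed
  have "integrable pos_lebesgue (\<lambda>x. (cmod (g x))\<^sup>2)"
  proof (rule Fatou_integrable(1))
    fix n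
    have n: "0 < inverse (real (Suc n))" "inverse (real (Suc n)) \<le> real (Suc n)"
      using inverse_le_1_iff[of "real (Suc n)"] by auto
    show "integrable pos_lebesgue (\<lambda>x. if x \<in> {inverse (real (Suc n))..real (Suc n)} then (cmod (g x))\<^sup>2 else 0)"
      by (rule int[OF n])
    show "(\<integral>x. (if x \<in> {inverse (real (Suc n))..real (Suc n)} then (cmod (g x))\<^sup>2 else 0) \<partial>pos_lebesgue) \<le> 2 * C"
      unfolding eq[OF n] using bound[OF n(1)] bound[of "real (Suc n)"] by simp
  next
    fix x :: real assume "x \<in> space pos_lebesgue"
    then have x: "x > 0" by (simp add: space_restrict_space)
    obtain N where N: "max x (inverse x) \<le> real N" using real_arch_simple by blast
    show "(\<lambda>n. if x \<in> {inverse (real (Suc n))..real (Suc n)} then (cmod (g x))\<^sup>2 else 0) \<longlonglongrightarrow> (cmod (g x))\<^sup>2"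
    proof (rule tendsto_eventually)
      show "\<forall>\<^sub>F n in sequentially. (if x \<in> {inverse (real (Suc n))..real (Suc n)} then (cmod (g x))\<^sup>2 else 0) = (cmod (g x))\<^sup>2"
        using eventually_ge_at_top[of N]
      proof eventually_elim
        case (elim n)
        then have n: "max x (inverse x) \<le> real (Suc n)" using N by simp
        then have "inverse (real (Suc n)) \<le> inverse (inverse x)"
          using x by (intro le_imp_inverse_le) auto
        then show ?case using n by simp
      qed
    qed
  qed auto
  with meas show L2: "g \<in> L2_pos" by (rule L2_posI)
  have "F 2 - F 1 \<le> (L2_norm g)\<^sup>2"
    unfolding eq[of 1 2, symmetric, simplified] L2_norm_power2
    by (rule integral_mono[OF int[of 1 2, simplified] L2_posD(2)[OF L2]]) auto
  then have "(L2_norm g)\<^sup>2 > 0" using less by linarith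
  then show "L2_norm g > 0" using L2_norm_nonneg[of g] by (simp add: order_less_le)
qed

section \<open>Approximate eigenfunctions\<close>

definition sech_wave :: "real \<Rightarrow> real \<Rightarrow> real \<Rightarrow> complex" where
  "sech_wave \<omega> \<epsilon> s = exp (\<i> * of_real \<omega> * of_real s) * of_real (1 / cosh (\<epsilon> * s))"

text \<open>With this multiplier \<open>z\<close>, \<open>w' = z w\<close> and
  \<open>w'' = (z\<^sup>2 + z') w\<close>, so differential operators act on \<open>w\<close> by
  pointwise multiplication. The profile \<open>1 / cosh\<close> serves well because \<open>z\<close>
  differs from \<open>\<i> * \<omega>\<close> by at most \<open>\<epsilon>\<close>, uniformly in
  \<open>s\<close>.\<close>

definition sech_wave_log_deriv :: "real \<Rightarrow> real \<Rightarrow> real \<Rightarrow> complex" where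
  "sech_wave_log_deriv \<omega> \<epsilon> s = \<i> * of_real \<omega> - of_real (\<epsilon> * tanh (\<epsilon> * s))"

lemma sech_wave_has_vector_derivative:
  "(sech_wave \<omega> \<epsilon> has_vector_derivative sech_wave_log_deriv \<omega> \<epsilon> s * sech_wave \<omega> \<epsilon> s) (at s)"
proof -
  have "((\<lambda>z. exp (\<i> * of_real \<omega> * z)) has_field_derivative exp (\<i> * of_real \<omega> * of_real s) * (\<i> * of_real \<omega>)) (at (of_real s))"
    by (auto intro!: derivative_eq_intros)
  note 1 = has_vector_derivative_real_field[OF this]
  have "((\<lambda>s. 1 / cosh (\<epsilon> * s)) has_real_derivative - (sinh (\<epsilon> * s) * \<epsilon>) / (cosh (\<epsilon> * s))\<^sup>2) (at s)"
    by (auto intro!: derivative_eq_intros simp: power2_eq_square)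
  note 2 = has_vector_derivative_of_real[OF this]
  show ?thesis
    using has_vector_derivative_mult[OF 1 2]
    unfolding sech_wave_def[abs_def] sech_wave_log_deriv_def tanh_def
    by (simp add: field_simps power2_eq_square)
qed

lemma sech_wave_log_deriv_has_vector_derivative:
  "(sech_wave_log_deriv \<omega> \<epsilon> has_vector_derivative - of_real (\<epsilon>\<^sup>2 * (1 - (tanh (\<epsilon> * s))\<^sup>2))) (at s)"
proof -
  have "((\<lambda>s. \<epsilon> * tanh (\<epsilon> * s)) has_real_derivative \<epsilon>\<^sup>2 * (1 - (tanh (\<epsilon> * s))\<^sup>2)) (at s)"
    by (auto intro!: derivative_eq_intros simp: power2_eq_square)
  note 1 = has_vector_derivative_of_real[OF this]
  show ?thesis
    using has_vector_derivative_diff[OF has_vector_derivative_const 1, of "\<i> * of_real \<omega>"]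
    unfolding sech_wave_log_deriv_def[abs_def] by simp
qed

lemma cmod_sech_wave: "cmod (sech_wave \<omega> \<epsilon> s) = 1 / cosh (\<epsilon> * s)"
  by (simp add: sech_wave_def norm_divide)

lemma abs_tanh_real_le_1: "\<bar>tanh (x::real)\<bar> \<le> 1"
  using tanh_real_bounds[of x] by auto

lemma cmod_sech_wave_le_1: "cmod (sech_wave \<omega> \<epsilon> s) \<le> 1"
  using cosh_real_ge_1[of "\<epsilon> * s"] by (simp add: cmod_sech_wave)

lemma cmod_sech_wave_log_deriv_le:
  assumes "0 \<le> \<epsilon>" "\<epsilon> \<le> 1"
  shows "cmod (sech_wave_log_deriv \<omega> \<epsilon> s) \<le> \<bar>\<omega>\<bar> + 1"
proof -
  have "\<bar>\<epsilon> * tanh (\<epsilon> * s)\<bar> \<le> 1 * 1"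
    unfolding abs_mult
    by (rule mult_mono) (use assms abs_tanh_real_le_1 in auto)
  then show ?thesis
    unfolding sech_wave_log_deriv_def
    by (intro norm_triangle_le_diff) (simp add: norm_mult)
qed

text \<open>Inserting \<open>z = \<i> * \<omega> - \<epsilon> * t\<close> yields the symbol at
  \<open>\<omega>\<close> plus \<open>\<epsilon>\<close> times a bounded remainder. The
  \<open>4\<close> collects 1 for \<open>\<epsilon> * t\<^sup>2\<close>, 1 for
  \<open>\<epsilon> * (1 - t\<^sup>2)\<close> and 2 for \<open>2 * t\<close>.\<close>

lemma sech_wave_symbol_le:
  fixes \<alpha> :: complex and \<omega> \<epsilon> s :: real
  assumes \<epsilon>: "0 \<le> \<epsilon>" "\<epsilon> \<le> 1"
  defines "z \<equiv> sech_wave_log_deriv \<omega> \<epsilon> s" and "t \<equiv> tanh (\<epsilon> * s)"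
  shows "cmod (z\<^sup>2 - of_real (\<epsilon>\<^sup>2 * (1 - t\<^sup>2)) + 2 * z + (1 - \<alpha>))
     \<le> cmod ((1 + \<i> * of_real \<omega>)\<^sup>2 - \<alpha>) + \<epsilon> * (2 * \<bar>\<omega>\<bar> + 4)"
proof -
  have t: "\<bar>t\<bar> \<le> 1" unfolding t_def by (rule abs_tanh_real_le_1)
  then have t2: "t\<^sup>2 \<le> 1" by (simp add: abs_square_le_1)
  have eq: "z\<^sup>2 - of_real (\<epsilon>\<^sup>2 * (1 - t\<^sup>2)) + 2 * z + (1 - \<alpha>)
    = ((1 + \<i> * of_real \<omega>)\<^sup>2 - \<alpha>) + of_real \<epsilon> * (of_real (\<epsilon> * t\<^sup>2 - \<epsilon> * (1 - t\<^sup>2) - 2 * t) - \<i> * of_real (2 * \<omega> * t))"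
    unfolding z_def sech_wave_log_deriv_def t_def[symmetric]
    by (simp add: power2_eq_square algebra_simps)
  have le: "cmod (of_real \<epsilon> * (of_real (\<epsilon> * t\<^sup>2 - \<epsilon> * (1 - t\<^sup>2) - 2 * t) - \<i> * of_real (2 * \<omega> * t))) \<le> \<epsilon> * (2 * \<bar>\<omega>\<bar> + 4)"
  proof -
    have "\<bar>\<omega>\<bar> * \<bar>t\<bar> \<le> \<bar>\<omega>\<bar> * 1" using t by (intro mult_left_mono) auto
    moreover have "\<epsilon> * t\<^sup>2 \<le> 1 * 1" "\<epsilon> * (1 - t\<^sup>2) \<le> 1 * 1" using \<epsilon> t2 by (intro mult_mono; simp)+
    moreover have "0 \<le> \<epsilon> * t\<^sup>2" "0 \<le> \<epsilon> * (1 - t\<^sup>2)" using \<epsilon> t2 by auto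
    ultimately have "\<bar>\<epsilon> * t\<^sup>2 - \<epsilon> * (1 - t\<^sup>2) - 2 * t\<bar> + \<bar>2 * \<omega> * t\<bar> \<le> 2 * \<bar>\<omega>\<bar> + 4"
      using t by (simp add: abs_mult)
    then have "cmod (of_real (\<epsilon> * t\<^sup>2 - \<epsilon> * (1 - t\<^sup>2) - 2 * t) - \<i> * of_real (2 * \<omega> * t)) \<le> 2 * \<bar>\<omega>\<bar> + 4"
      by (intro norm_triangle_le_diff) (simp only: norm_of_real norm_mult norm_ii mult_1_left)
    moreover have "cmod (of_real \<epsilon> * y) = \<epsilon> * cmod y" for y
      using \<epsilon> by (simp add: norm_mult)
    ultimately show ?thesis using \<epsilon>(1) by (simp only: mult_left_mono)
  qed
  show ?thesis
    unfolding eq by (rule order_trans[OF norm_triangle_ineq add_left_mono[OF le]])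
qed

lemma one_minus_tanh_real_square: "1 - (tanh (x::real))\<^sup>2 = 1 / (cosh x)\<^sup>2"
proof -
  have "(cosh x)\<^sup>2 \<noteq> 0" using cosh_real_pos[of x] by simp
  then have "1 - (tanh x)\<^sup>2 = ((cosh x)\<^sup>2 - (sinh x)\<^sup>2) / (cosh x)\<^sup>2"
    by (simp add: tanh_def power_divide diff_divide_distrib)
  then show ?thesis by (simp only: hyperbolic_pythagoras)
qed

text \<open>The power of \<open>x\<close> undoes the substitution
  \<open>w(s) = exp (s/2) * h(exp s)\<close>.\<close>

definition sech_eigenfunction :: "real \<Rightarrow> real \<Rightarrow> real \<Rightarrow> complex" where
  "sech_eigenfunction \<omega> \<epsilon> x = of_real (x powr (-1/2)) * sech_wave \<omega> \<epsilon> (ln x)"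

text \<open>The quotient of \<open>p(\<partial>) w\<close> by \<open>w\<close>; the first two terms
  are \<open>w'' / w = z\<^sup>2 + z'\<close>.\<close>

definition sech_symbol :: "complex \<Rightarrow> real \<Rightarrow> real \<Rightarrow> real \<Rightarrow> complex" where
  "sech_symbol \<alpha> \<omega> \<epsilon> s = (sech_wave_log_deriv \<omega> \<epsilon> s)\<^sup>2 - of_real (\<epsilon>\<^sup>2 * (1 - (tanh (\<epsilon> * s))\<^sup>2))
     + 2 * sech_wave_log_deriv \<omega> \<epsilon> s + (1 - \<alpha>)"

definition sech_source :: "complex \<Rightarrow> real \<Rightarrow> real \<Rightarrow> real \<Rightarrow> complex" where
  "sech_source \<alpha> \<omega> \<epsilon> x = sech_symbol \<alpha> \<omega> \<epsilon> (ln x) * sech_eigenfunction \<omega> \<epsilon> x"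

lemma continuous_on_sech_wave:
  "continuous_on A (sech_wave \<omega> \<epsilon>)"
  by (rule continuous_on_vector_derivative[OF has_vector_derivative_at_within[OF sech_wave_has_vector_derivative]])

lemma continuous_on_sech_wave_ln:
  "continuous_on {0<..} (\<lambda>x. sech_wave \<omega> \<epsilon> (ln x))"
  by (rule continuous_on_compose2[OF continuous_on_sech_wave[of UNIV]]) (auto intro!: continuous_intros)

lemma continuous_on_sech_symbol_ln:
  "continuous_on {0<..} (\<lambda>x. sech_symbol \<alpha> \<omega> \<epsilon> (ln x))"
  unfolding sech_symbol_def sech_wave_log_deriv_def
  by (auto intro!: continuous_intros simp: less_imp_neq[OF cosh_real_pos])

lemma continuous_on_sech_eigenfunction: "continuous_on {0<..} (sech_eigenfunction \<omega> \<epsilon>)"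
  unfolding sech_eigenfunction_def by (intro continuous_intros continuous_on_sech_wave_ln) auto

text \<open>The squared modulus has the explicit antiderivative
  \<open>tanh (\<epsilon> * ln x) / \<epsilon>\<close>, which is bounded by
  \<open>1 / \<epsilon>\<close>.\<close>

lemma
  assumes \<epsilon>: "\<epsilon> > 0"
  shows sech_eigenfunction_L2_pos: "sech_eigenfunction \<omega> \<epsilon> \<in> L2_pos"
    and sech_eigenfunction_norm_pos: "L2_norm (sech_eigenfunction \<omega> \<epsilon>) > 0"
proof -
  have sq: "(cmod (sech_eigenfunction \<omega> \<epsilon> x))\<^sup>2 = (1 - (tanh (\<epsilon> * ln x))\<^sup>2) / x" if "x > 0" for x
  proof -
    have "(x powr (-1/2))\<^sup>2 = 1 / x" using that by (simp add: powr_minus_divide powr_half_sqrt power_divide)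
    then show ?thesis
      by (simp add: sech_eigenfunction_def norm_mult cmod_sech_wave one_minus_tanh_real_square power_mult_distrib power_divide
        del: minus_divide_left)
  qed
  have deriv: "((\<lambda>x. tanh (\<epsilon> * ln x) / \<epsilon>) has_vector_derivative (1 - (tanh (\<epsilon> * ln x))\<^sup>2) / x) (at x)" if "x > 0" for x
    unfolding has_real_derivative_iff_has_vector_derivative[symmetric]
    using that \<epsilon> by (auto intro!: derivative_eq_intros simp: less_imp_neq[OF cosh_real_pos, symmetric])
  have bound: "\<bar>tanh (\<epsilon> * ln x) / \<epsilon>\<bar> \<le> 1 / \<epsilon>" for x
    using \<epsilon> abs_tanh_real_le_1[of "\<epsilon> * ln x"] by (simp add: abs_divide divide_right_mono)
  have less: "tanh (\<epsilon> * ln 1) / \<epsilon> < tanh (\<epsilon> * ln 2) / \<epsilon>" using \<epsilon> by simp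
  show "sech_eigenfunction \<omega> \<epsilon> \<in> L2_pos" "L2_norm (sech_eigenfunction \<omega> \<epsilon>) > 0"
    using L2_posI_antiderivative[OF continuous_on_sech_eigenfunction sq deriv bound less]
      L2_norm_pos_antiderivative[OF continuous_on_sech_eigenfunction sq deriv bound less] by auto
qed

lemma
  assumes \<epsilon>: "0 < \<epsilon>" "\<epsilon> \<le> 1"
  shows sech_source_L2_pos: "sech_source \<alpha> \<omega> \<epsilon> \<in> L2_pos"
    and sech_source_norm_le: "L2_norm (sech_source \<alpha> \<omega> \<epsilon>) \<le>
      (cmod ((1 + \<i> * of_real \<omega>)\<^sup>2 - \<alpha>) + \<epsilon> * (2 * \<bar>\<omega>\<bar> + 4)) * L2_norm (sech_eigenfunction \<omega> \<epsilon>)"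
proof -
  have meas: "sech_source \<alpha> \<omega> \<epsilon> \<in> borel_measurable pos_lebesgue"
    unfolding sech_source_def
    by (intro borel_measurable_pos_lebesgue_continuous continuous_intros
        continuous_on_sech_symbol_ln continuous_on_sech_eigenfunction)
  have le: "cmod (sech_source \<alpha> \<omega> \<epsilon> x) \<le>
      (cmod ((1 + \<i> * of_real \<omega>)\<^sup>2 - \<alpha>) + \<epsilon> * (2 * \<bar>\<omega>\<bar> + 4)) * cmod (sech_eigenfunction \<omega> \<epsilon> x)" for x
    unfolding sech_source_def sech_symbol_def norm_mult[of _ "sech_eigenfunction \<omega> \<epsilon> x"]
    using \<epsilon> by (intro mult_right_mono sech_wave_symbol_le) auto
  have nonneg: "cmod ((1 + \<i> * of_real \<omega>)\<^sup>2 - \<alpha>) + \<epsilon> * (2 * \<bar>\<omega>\<bar> + 4) \<ge> 0"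
    using \<epsilon> by simp
  note L2_pos_bound[OF sech_eigenfunction_L2_pos[OF \<epsilon>(1)] meas le nonneg]
  then show "sech_source \<alpha> \<omega> \<epsilon> \<in> L2_pos" "L2_norm (sech_source \<alpha> \<omega> \<epsilon>) \<le>
      (cmod ((1 + \<i> * of_real \<omega>)\<^sup>2 - \<alpha>) + \<epsilon> * (2 * \<bar>\<omega>\<bar> + 4)) * L2_norm (sech_eigenfunction \<omega> \<epsilon>)" .
qed

lemma has_vector_derivative_reflect:
  assumes "\<And>u. (f has_vector_derivative f' u) (at u)"
  shows "((\<lambda>s. f (c - s)) has_vector_derivative - f' (c - s)) (at s)"
proof -
  have "((\<lambda>s. c - s) has_vector_derivative (-1)) (at s)"
    by (auto intro!: derivative_eq_intros)
  from vector_diff_chain_at[OF this assms] show ?thesis by (simp add: o_def)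
qed

text \<open>The source has no compact support, so the equation is verified directly through an
  antiderivative \<open>G\<close>, as in Green's formula. At \<open>y = x\<close> only the term with
  \<open>C\<close> survives because \<open>S x = 0\<close> and \<open>C x = 1\<close>; as
  \<open>y\<close> tends to 0, so does \<open>G\<close>.\<close>

lemma Q_op_sech_source:
  assumes \<alpha>: "\<bar>Re (csqrt \<alpha>)\<bar> < 1" and \<epsilon>: "0 < \<epsilon>" "\<epsilon> \<le> 1" and x: "x > 0"
  shows "Q_op \<alpha> (sech_source \<alpha> \<omega> \<epsilon>) x = sech_eigenfunction \<omega> \<epsilon> x"
proof -
  define m where "m = csqrt \<alpha>"
  have m2: "m\<^sup>2 = \<alpha>" by (simp add: m_def)
  let ?S = "sinh_div m" and ?C = "cosh_mult m"
  let ?w = "sech_wave \<omega> \<epsilon>" and ?z = "sech_wave_log_deriv \<omega> \<epsilon>"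
  let ?g = "sech_source \<alpha> \<omega> \<epsilon>"
  define S where "S = (\<lambda>y. ?S (ln x - ln y))"
  define C where "C = (\<lambda>y. ?C (ln x - ln y))"
  define w where "w = (\<lambda>y. ?w (ln y))"
  define z where "z = (\<lambda>y. ?z (ln y))"
  define z' where "z' = (\<lambda>y. - complex_of_real (\<epsilon>\<^sup>2 * (1 - (tanh (\<epsilon> * ln y))\<^sup>2)))"
  \<comment> \<open>\<open>x\<close> times an antiderivative of \<open>K(s - r) (w'' + 2 w' + (1 - \<alpha>) w)\<close> in \<open>r = ln y\<close>, where \<open>s = ln x\<close>
    and \<open>K(u) = exp (- u) sinh (m u) / m\<close> solves \<open>K'' + 2 K' + (1 - \<alpha>) K = 0\<close>.\<close>
  define G where "G = (\<lambda>y. of_real y * (S y * (z y * w y + w y) + C y * w y))"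
  define k where "k = (\<lambda>y. of_real (x powr (-3/2)) * (S y * (sech_symbol \<alpha> \<omega> \<epsilon> (ln y) * w y)))"
  have D: "(S has_vector_derivative - C y / of_real y) (at y within A)"
    "(C has_vector_derivative - (m\<^sup>2 * S y) / of_real y) (at y within A)"
    "(w has_vector_derivative (z y * w y) / of_real y) (at y within A)"
    "(z has_vector_derivative z' y / of_real y) (at y within A)" if "y > 0" for y A
    unfolding S_def C_def w_def z_def z'_def
    by (rule has_vector_derivative_compose_ln[OF has_vector_derivative_reflect[OF sinh_div_has_vector_derivative] that]
        has_vector_derivative_compose_ln[OF has_vector_derivative_reflect[OF cosh_mult_has_vector_derivative] that]
        has_vector_derivative_compose_ln[OF sech_wave_has_vector_derivative that]
        has_vector_derivative_compose_ln[OF sech_wave_log_deriv_has_vector_derivative that])+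
  have G_deriv: "(G has_vector_derivative S y * (sech_symbol \<alpha> \<omega> \<epsilon> (ln y) * w y)) (at y within A)" if y: "y > 0" for y A
  proof -
    have "(complex_of_real has_vector_derivative 1) (at y within A)"
      by (auto intro!: derivative_eq_intros simp: has_vector_derivative_def scaleR_conv_of_real)
    then have "(G has_vector_derivative
       of_real y * ((S y * ((z y * (z y * w y / of_real y) + z' y / of_real y * w y) + z y * w y / of_real y) + - C y / of_real y * (z y * w y + w y))
         + (C y * (z y * w y / of_real y) + - (m\<^sup>2 * S y) / of_real y * w y))
       + 1 * (S y * (z y * w y + w y) + C y * w y)) (at y within A)"
      unfolding G_def by (intro has_vector_derivative_mult has_vector_derivative_add D y)
    \<comment> \<open>The terms with \<open>C y\<close> cancel, and what multiplies
      \<open>S y * w y\<close> is the symbol.\<close>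
    also have "of_real y * ((S y * ((z y * (z y * w y / of_real y) + z' y / of_real y * w y) + z y * w y / of_real y) + - C y / of_real y * (z y * w y + w y))
         + (C y * (z y * w y / of_real y) + - (m\<^sup>2 * S y) / of_real y * w y))
       + 1 * (S y * (z y * w y + w y) + C y * w y) = S y * (((z y)\<^sup>2 + z' y + 2 * z y + (1 - m\<^sup>2)) * w y)"
      using y by (simp add: field_simps power2_eq_square)
    also have "(z y)\<^sup>2 + z' y + 2 * z y + (1 - m\<^sup>2) = sech_symbol \<alpha> \<omega> \<epsilon> (ln y)"
      by (simp add: sech_symbol_def z_def z'_def m2)
    finally show ?thesis .
  qed
  have k_eq: "Q_kernel \<alpha> x y * ?g y = (if y \<le> x then k y else 0)" if y: "y > 0" for y
  proof -
    have "complex_of_real (y powr (1/2)) * of_real (y powr (-1/2)) = 1"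
      using y by (simp flip: of_real_mult powr_add)
    moreover have "of_real (p * q) * s * (t * (r * v)) = of_real p * (s * (t * v)) * (of_real q * r)" for p q and s t r v :: complex
      by simp
    ultimately show ?thesis
      using x y by (simp add: Q_kernel_eq sech_source_def sech_eigenfunction_def k_def S_def w_def m_def[symmetric])
  qed
  have k_int: "(\<integral>y. (if y \<in> {a..x} then k y else 0) \<partial>pos_lebesgue) = of_real (x powr (-3/2)) * (G x - G a)"
    if a: "0 < a" "a \<le> x" for a
  proof -
    have "continuous_on {a..x} k"
      unfolding k_def S_def w_def using a x
      by (auto intro!: continuous_intros continuous_on_subset[OF continuous_on_sech_symbol_ln]
          continuous_on_subset[OF continuous_on_sech_wave_ln])
    then have "(\<integral>y. (if y \<in> {a..x} then k y else 0) \<partial>pos_lebesgue) = integral {a..x} k"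
      using a by (intro integral_pos_lebesgue_compact)
    also have "(k has_integral of_real (x powr (-3/2)) * (G x - G a)) {a..x}"
      unfolding k_def using a G_deriv
      by (intro has_integral_mult_right fundamental_theorem_of_calculus) auto
    then have "integral {a..x} k = of_real (x powr (-3/2)) * (G x - G a)" by (rule integral_unique)
    finally show ?thesis .
  qed
  \<comment> \<open>The derivative of \<open>G\<close> is available for positive arguments only, so
    the fundamental theorem is applied on \<open>{a n..x}\<close> and the left end then tends to
    0.\<close>
  define a where "a = (\<lambda>n. inverse (real (Suc n)))"
  have a0: "a n > 0" for n by (simp add: a_def)
  have a_lim: "a \<longlonglongrightarrow> 0" unfolding a_def by (rule LIMSEQ_inverse_real_of_nat)
  have a_le: "\<forall>\<^sub>F n in sequentially. a n \<le> y" if "y > 0" for y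
    using order_tendstoD(2)[OF a_lim that] by eventually_elim simp
  have int: "integrable pos_lebesgue (\<lambda>y. Q_kernel \<alpha> x y * ?g y)"
    by (rule Q_op_integrable[OF \<alpha> sech_source_L2_pos[OF \<epsilon>] x])
  have lim1: "(\<lambda>n. \<integral>y. (if y \<in> {a n..x} then k y else 0) \<partial>pos_lebesgue) \<longlonglongrightarrow> Q_op \<alpha> ?g x"
    unfolding Q_op_def
  proof (rule integral_dominated_convergence)
    show "integrable pos_lebesgue (\<lambda>y. cmod (Q_kernel \<alpha> x y * ?g y))" using int by simp
    show "(\<lambda>y. if y \<in> {a n..x} then k y else 0) \<in> borel_measurable pos_lebesgue" for n
    proof -
      have [measurable]: "(\<lambda>y. Q_kernel \<alpha> x y * ?g y) \<in> borel_measurable pos_lebesgue" using int by simp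
      have "(\<lambda>y. if a n \<le> y then Q_kernel \<alpha> x y * ?g y else 0) \<in> borel_measurable pos_lebesgue" by measurable
      then show ?thesis
        by (rule measurable_cong[THEN iffD1, rotated]) (auto simp: k_eq space_restrict_space)
    qed
    show "AE y in pos_lebesgue. (\<lambda>n. if y \<in> {a n..x} then k y else 0) \<longlonglongrightarrow> Q_kernel \<alpha> x y * ?g y"
    proof (rule AE_I2)
      fix y assume "y \<in> space pos_lebesgue"
      then have y: "y > 0" by (simp add: space_restrict_space)
      show "(\<lambda>n. if y \<in> {a n..x} then k y else 0) \<longlonglongrightarrow> Q_kernel \<alpha> x y * ?g y"
        by (rule tendsto_eventually, use a_le[OF y] in eventually_elim) (simp add: k_eq[OF y])
    qed
    show "AE y in pos_lebesgue. norm (if y \<in> {a n..x} then k y else 0) \<le> cmod (Q_kernel \<alpha> x y * ?g y)" for n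
      by (rule AE_I2) (auto simp: k_eq space_restrict_space)
  qed (use int in simp)
  have G_lim: "(\<lambda>n. G (a n)) \<longlonglongrightarrow> 0"
  proof -
    obtain c \<rho> where c: "c > 0" "0 < \<rho>" "\<rho> < 1"
      and bound: "\<And>u. u \<ge> 0 \<Longrightarrow> norm (?S u) \<le> c * exp (\<rho> * u)" "\<And>u. u \<ge> 0 \<Longrightarrow> norm (?C u) \<le> c * exp (\<rho> * u)"
      using sinh_cosh_growth[of m] \<alpha> unfolding m_def by metis
    \<comment> \<open>Each hyperbolic factor is at most \<open>c * (x / y) powr \<rho>\<close>, so
      the prefactor \<open>y\<close> of \<open>G\<close> leaves \<open>y powr (1 - \<rho>)\<close>.
      In \<open>\<bar>\<omega>\<bar> + 3\<close>, the product \<open>z * w\<close> accounts for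
      \<open>\<bar>\<omega>\<bar> + 1\<close> and the two other occurrences of \<open>w\<close> for
      1 each.\<close>
    have G_le: "cmod (G y) \<le> c * x powr \<rho> * (\<bar>\<omega>\<bar> + 3) * y powr (1 - \<rho>)" if y: "0 < y" "y \<le> x" for y
    proof -
      define B where "B = c * exp (\<rho> * (ln x - ln y))"
      have SC: "cmod (S y) \<le> B" "cmod (C y) \<le> B"
        unfolding S_def C_def B_def using bound[of "ln x - ln y"] y x by auto
      have w: "cmod (w y) \<le> 1" unfolding w_def by (rule cmod_sech_wave_le_1)
      have z: "cmod (z y) \<le> \<bar>\<omega>\<bar> + 1"
        unfolding z_def by (rule cmod_sech_wave_log_deriv_le) (use \<epsilon> in auto)
      have B0: "B \<ge> 0" using c by (simp add: B_def)
      have "cmod (z y * w y + w y) \<le> (\<bar>\<omega>\<bar> + 1) * 1 + 1"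
        by (rule norm_triangle_le, rule add_mono[OF _ w]) (unfold norm_mult, rule mult_mono[OF z w], auto)
      then have "cmod (S y * (z y * w y + w y) + C y * w y) \<le> B * ((\<bar>\<omega>\<bar> + 1) * 1 + 1) + B * 1"
        using SC w B0 by (intro norm_triangle_le add_mono; unfold norm_mult; intro mult_mono) auto
      then have "cmod (G y) \<le> y * (B * ((\<bar>\<omega>\<bar> + 1) * 1 + 1) + B * 1)"
        using y by (simp add: G_def norm_mult)
      also have "\<dots> = (B * y) * (\<bar>\<omega>\<bar> + 3)" by (simp add: algebra_simps)
      also have "B * y = c * (x powr \<rho> * y powr (1 - \<rho>))"
        using x y by (simp add: B_def powr_def exp_add[symmetric] algebra_simps) (simp add: exp_diff exp_add exp_minus field_simps)
      finally show ?thesis by (simp add: mult_ac)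
    qed
    have "(\<lambda>n. c * x powr \<rho> * (\<bar>\<omega>\<bar> + 3) * a n powr (1 - \<rho>)) \<longlonglongrightarrow> c * x powr \<rho> * (\<bar>\<omega>\<bar> + 3) * 0 powr (1 - \<rho>)"
      using c less_imp_le[OF a0] by (intro tendsto_intros tendsto_powr' a_lim) auto
    then have "(\<lambda>n. c * x powr \<rho> * (\<bar>\<omega>\<bar> + 3) * a n powr (1 - \<rho>)) \<longlonglongrightarrow> 0" by simp
    then show ?thesis
      by (rule Lim_null_comparison[rotated]) (use a_le[OF x] in eventually_elim, rule G_le[OF a0])
  qed
  have "(\<lambda>n. of_real (x powr (-3/2)) * (G x - G (a n))) \<longlonglongrightarrow> of_real (x powr (-3/2)) * (G x - 0)"
    by (intro tendsto_intros G_lim)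
  moreover have "\<forall>\<^sub>F n in sequentially. (\<integral>y. (if y \<in> {a n..x} then k y else 0) \<partial>pos_lebesgue) = of_real (x powr (-3/2)) * (G x - G (a n))"
    using a_le[OF x] by eventually_elim (rule k_int[OF a0])
  ultimately have "(\<lambda>n. \<integral>y. (if y \<in> {a n..x} then k y else 0) \<partial>pos_lebesgue) \<longlonglongrightarrow> of_real (x powr (-3/2)) * (G x - 0)"
    by (simp only: tendsto_cong)
  from LIMSEQ_unique[OF lim1 this]
  have "Q_op \<alpha> ?g x = of_real (x powr (-3/2)) * (of_real x * ?w (ln x))"
    by (simp add: G_def S_def C_def w_def)
  moreover have "x powr (-3/2) * x = x powr (-1/2)" using x powr_mult_base[of x "-3/2"] by (simp add: mult.commute)
  ultimately show ?thesis
    by (simp add: sech_eigenfunction_def mult.assoc[symmetric] of_real_mult[symmetric] del: of_real_mult)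
qed

section \<open>The operator norm from both bounds\<close>

theorem proposition3p2:
  fixes \<alpha> :: complex
  assumes "\<bar>Re (csqrt \<alpha>)\<bar> < 1"
  shows "Q_op_well_defined \<alpha> \<and> L2_bounded_operator (Q_op \<alpha>) \<and>
    L2_onorm (Q_op \<alpha>) = 1 / infdist \<alpha> {(1 + \<i> * complex_of_real \<omega>)\<^sup>2 | \<omega>. True}"
proof -
  obtain \<omega> where dist: "infdist \<alpha> {(1 + \<i> * complex_of_real \<omega>)\<^sup>2 | \<omega>. True} = cmod ((1 + \<i> * complex_of_real \<omega>)\<^sup>2 - \<alpha>)"
    and min: "\<And>\<omega>'. cmod ((1 + \<i> * complex_of_real \<omega>)\<^sup>2 - \<alpha>) \<le> cmod ((1 + \<i> * complex_of_real \<omega>')\<^sup>2 - \<alpha>)"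
    using parabola_nearest_point[of \<alpha>] by blast
  define d where "d = cmod ((1 + \<i> * complex_of_real \<omega>)\<^sup>2 - \<alpha>)"
  define b1 where "b1 = 1 - Re \<alpha>"
  define b2 where "b2 = - Im \<alpha>"
  have \<beta>: "\<alpha> = 1 - Complex b1 b2" by (simp add: complex_eq_iff b1_def b2_def)
  have sq: "(cmod ((1 + \<i> * complex_of_real t)\<^sup>2 - \<alpha>))\<^sup>2 = (b1 - t\<^sup>2)\<^sup>2 + (b2 + 2 * t)\<^sup>2" for t
  proof -
    have "(1 + \<i> * complex_of_real t)\<^sup>2 - \<alpha> = Complex (b1 - t\<^sup>2) (b2 + 2 * t)"
      by (simp add: complex_eq_iff b1_def b2_def power2_eq_square)
    then show ?thesis by (simp add: cmod_power2)
  qed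
  have "(b1 - \<omega>\<^sup>2)\<^sup>2 + (b2 + 2 * \<omega>)\<^sup>2 \<le> (b1 - t\<^sup>2)\<^sup>2 + (b2 + 2 * t)\<^sup>2" for t
    unfolding sq[symmetric] using min by (intro power_mono) auto
  note crit = quartic_minimum_conditions[OF this]
  \<comment> \<open>The second condition at the minimum makes a real \<open>\<gamma>\<close>
    available.\<close>
  have \<gamma>: "(sqrt (4 - 2 * b1 + 2 * \<omega>\<^sup>2))\<^sup>2 = 4 - 2 * b1 + 2 * \<omega>\<^sup>2" using crit(2) by simp
  have d0: "d > 0" unfolding d_def by (rule parabola_distance_pos[OF assms])
  note estimate = Q_op_estimate[OF _ assms \<beta> \<gamma> crit(1) sq[of \<omega>, folded d_def] d0]
  have well_defined: "Q_op_well_defined \<alpha>"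
    unfolding Q_op_well_defined_def
    by (intro ballI AE_I2 Q_op_integrable assms) (simp_all add: space_restrict_space)
  have bounded: "L2_bounded_operator (Q_op \<alpha>)"
    unfolding L2_bounded_operator_def
  proof (intro conjI ballI allI AE_I2 exI)
    fix g h :: "real \<Rightarrow> complex" and c :: complex
    assume g: "g \<in> L2_pos"
    show "Q_op \<alpha> g \<in> L2_pos" by (rule estimate(1)[OF g])
    show "L2_norm (Q_op \<alpha> g) \<le> (1 / d) * L2_norm g" using estimate(2)[OF g] by simp
    fix x assume "x \<in> space pos_lebesgue"
    then have x: "x > 0" by (simp add: space_restrict_space)
    show "Q_op \<alpha> (\<lambda>y. c * g y) x = c * Q_op \<alpha> g x"
      by (simp add: Q_op_def mult.left_commute)
    assume h: "h \<in> L2_pos"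
    show "Q_op \<alpha> (\<lambda>y. g y + h y) x = Q_op \<alpha> g x + Q_op \<alpha> h x"
      unfolding Q_op_def distrib_left
      by (rule Bochner_Integration.integral_add) (intro Q_op_integrable assms g h x)+
  qed
  \<comment> \<open>If \<open>g\<close> has norm 0, the quotient is 0 by convention and the bound is
    trivial.\<close>
  have ratio_le: "L2_norm (Q_op \<alpha> g) / L2_norm g \<le> 1 / d" if "g \<in> L2_pos" for g
    using estimate(2)[OF that] d0 L2_norm_nonneg[of g]
    by (cases "L2_norm g = 0") (auto simp: field_simps)
  \<comment> \<open>The test function is the source: its image, the approximate eigenfunction, has
    at least the norm of the source divided by
    \<open>d + \<epsilon> * (2 * \<bar>\<omega>\<bar> + 4)\<close>.\<close>
  have ratio_ge: "1 \<le> L2_onorm (Q_op \<alpha>) * (d + \<epsilon> * (2 * \<bar>\<omega>\<bar> + 4))" if \<epsilon>: "0 < \<epsilon>" "\<epsilon> \<le> 1" for \<epsilon>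
  proof -
    let ?g = "sech_source \<alpha> \<omega> \<epsilon>" and ?h = "sech_eigenfunction \<omega> \<epsilon>" and ?D = "d + \<epsilon> * (2 * \<bar>\<omega>\<bar> + 4)"
    have g: "?g \<in> L2_pos" by (rule sech_source_L2_pos[OF \<epsilon>])
    have h: "L2_norm (Q_op \<alpha> ?g) = L2_norm ?h"
      unfolding L2_norm_def
      by (intro arg_cong[where f = sqrt] Bochner_Integration.integral_cong refl)
        (simp add: Q_op_sech_source[OF assms \<epsilon>] space_restrict_space)
    have h0: "L2_norm ?h > 0" by (rule sech_eigenfunction_norm_pos[OF \<epsilon>(1)])
    have "L2_norm ?h \<le> L2_norm ?g / d" using estimate(2)[OF g] by (simp add: h)
    \<comment> \<open>The upper bound rules out a source of norm 0, because its image has positive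
      norm.\<close>
    then have g0: "L2_norm ?g > 0" using h0 d0 by (auto simp: field_simps intro: less_le_trans[of 0 "d * L2_norm ?h"])
    have le: "L2_norm ?g \<le> ?D * L2_norm ?h"
      using sech_source_norm_le[OF \<epsilon>, of \<alpha> \<omega>] by (simp add: d_def)
    have D0: "?D > 0" using d0 \<epsilon> by (simp add: add_pos_nonneg)
    have "1 \<le> (L2_norm ?h / L2_norm ?g) * ?D" using le g0 by (simp add: field_simps)
    \<comment> \<open>A real supremum dominates its members only if they are bounded above;
      \<open>ratio_le\<close> supplies this.\<close>
    also have "L2_norm ?h / L2_norm ?g \<le> L2_onorm (Q_op \<alpha>)"
      unfolding L2_onorm_def h[symmetric]
      by (rule cSUP_upper[OF g]) (use ratio_le in \<open>auto intro!: bdd_aboveI2\<close>)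
    then have "(L2_norm ?h / L2_norm ?g) * ?D \<le> L2_onorm (Q_op \<alpha>) * ?D" using D0 by (intro mult_right_mono) auto
    finally show ?thesis .
  qed
  \<comment> \<open>Letting \<open>\<epsilon>\<close> tend to 0 from the right leaves the factor
    \<open>d\<close>.\<close>
  have "((\<lambda>\<epsilon>. L2_onorm (Q_op \<alpha>) * (d + \<epsilon> * (2 * \<bar>\<omega>\<bar> + 4))) \<longlongrightarrow> L2_onorm (Q_op \<alpha>) * (d + 0 * (2 * \<bar>\<omega>\<bar> + 4))) (at_right 0)"
    by (intro tendsto_intros)
  then have "1 \<le> L2_onorm (Q_op \<alpha>) * (d + 0 * (2 * \<bar>\<omega>\<bar> + 4))"
  proof (rule tendsto_lowerbound)
    show "\<forall>\<^sub>F \<epsilon> in at_right 0. 1 \<le> L2_onorm (Q_op \<alpha>) * (d + \<epsilon> * (2 * \<bar>\<omega>\<bar> + 4))"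
      using eventually_at_right_less[of "0::real"] eventually_at_right_field[of "\<lambda>\<epsilon>. \<epsilon> \<le> 1" "0::real"]
      by (auto simp: eventually_at_right_field intro!: exI[of _ 1] ratio_ge)
  qed simp
  then have "1 / d \<le> L2_onorm (Q_op \<alpha>)" using d0 by (simp add: field_simps)
  moreover have "L2_onorm (Q_op \<alpha>) \<le> 1 / d"
    unfolding L2_onorm_def
  proof (rule cSUP_least)
    have "(\<lambda>_. 0) \<in> L2_pos" by (simp add: L2_pos_def)
    then show "L2_pos \<noteq> {}" by auto
  qed (rule ratio_le)
  ultimately have "L2_onorm (Q_op \<alpha>) = 1 / d" by simp
  then show ?thesis using well_defined bounded unfolding dist d_def by blast
qed

end
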